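(* Let $0<\gamma\le\frac18$ be arbitrary and let $b$ be a real number with $\frac{1}{2(1-3\gamma)}<b<\frac{1}{2\gamma}$. Then there is at most one $D$, and at most one primitive real character $\chi_D$ modulo $D$, such that $L(s,\chi_D)$ vanishes somewhere in the interval $$\left[1-\min\left(\gamma,\ \frac{c_1}{32\,\log^{5}D\cdot D^{b\gamma}}\right),\ 1\right].$$
   Context: $L(s,\chi)$ denotes the Dirichlet $L$-function of $\chi$; the moduli considered satisfy $D>1$, so that a primitive character modulo $D$ is non-principal. A complex character is one that is not real-valued. The constant $c_1>0$ is an effective constant with the following property: whenever $\chi_k$ is a non-principal character modulo $k$ such that $L(s,\chi_k)$ has a zero $s_0=1-\gamma+it$ with $0<\gamma<\frac14$ if $\chi_k$ is real, or $0<\gamma\le\frac18$ if $\chi_k$ is complex, and $\chi_D$ is a real non-principal character modulo $D$ with $\chi_k\chi_D$ non-principal, one has $L(1,\chi_D)\ge \dfrac{c_1}{U^{b\gamma}\log^3U}$ for every $b$ with $\frac{1}{2(1-3\gamma)}<b<\frac1{2\gamma}$, where $U=k|s_0|D$. *)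

theory Defs
  imports "HOL-Analysis.Analysis"
begin

definition dirichlet_char :: "nat \<Rightarrow> (nat \<Rightarrow> complex) \<Rightarrow> bool" where
  "dirichlet_char k chi \<longleftrightarrow>
     k > 0 \<and>
     (\<forall>m n. chi (m * n) = chi m * chi n) \<and>
     (\<forall>n. chi (n + k) = chi n) \<and>
     (\<forall>n. chi n = 0 \<longleftrightarrow> \<not> coprime n k)"

definition principal_char :: "nat \<Rightarrow> nat \<Rightarrow> complex" where
  "principal_char k n = (if coprime n k then 1 else 0)"

definition nonprincipal_char :: "nat \<Rightarrow> (nat \<Rightarrow> complex) \<Rightarrow> bool" where
  "nonprincipal_char k chi \<longleftrightarrow> dirichlet_char k chi \<and> chi \<noteq> principal_char k"

definition real_char :: "(nat \<Rightarrow> complex) \<Rightarrow> bool" where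
  "real_char chi \<longleftrightarrow> (\<forall>n. chi n \<in> \<real>)"

definition induced_char :: "nat \<Rightarrow> (nat \<Rightarrow> complex) \<Rightarrow> nat \<Rightarrow> (nat \<Rightarrow> complex) \<Rightarrow> bool" where
  "induced_char k chi d \<psi> \<longleftrightarrow>
     dirichlet_char d \<psi> \<and> d dvd k \<and> (\<forall>n. coprime n k \<longrightarrow> chi n = \<psi> n)"

definition primitive_char :: "nat \<Rightarrow> (nat \<Rightarrow> complex) \<Rightarrow> bool" where
  "primitive_char k chi \<longleftrightarrow>
     dirichlet_char k chi \<and> \<not> (\<exists>d \<psi>. d < k \<and> induced_char k chi d \<psi>)"

text \<open>
  The sum is taken in the order of increasing \<open>n\<close>. For a non-principal character the series
  converges (conditionally when \<open>Re s \<le> 1\<close>) throughout \<open>Re s > 0\<close>, where its sum is the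
  analytic continuation of the \<open>L\<close>-function from \<open>Re s > 1\<close>. Below, \<open>dirichlet_L\<close> is used
  only for non-principal characters and only at points with \<open>Re s > 3/4\<close>.
\<close>
definition dirichlet_L :: "(nat \<Rightarrow> complex) \<Rightarrow> complex \<Rightarrow> complex" where
  "dirichlet_L chi s = (\<Sum>n. chi (Suc n) / of_nat (Suc n) powr s)"

text \<open>
  \<open>L(1, chiD)\<close> is a real number because \<open>chiD\<close> is real-valued; \<open>Re\<close> only changes the type.
  The product of the two characters is a character modulo \<open>k * D\<close>.
\<close>
definition deuring_constant :: "real \<Rightarrow> bool" where
  "deuring_constant c \<longleftrightarrow> c > 0 \<and>
     (\<forall>k chik D chiD \<gamma> t b.
        let s\<^sub>0 = Complex (1 - \<gamma>) t; U = real k * cmod s\<^sub>0 * real D in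
        nonprincipal_char k chik \<longrightarrow>
        dirichlet_L chik s\<^sub>0 = 0 \<longrightarrow>
        0 < \<gamma> \<longrightarrow>
        (if real_char chik then \<gamma> < 1/4 else \<gamma> \<le> 1/8) \<longrightarrow>
        nonprincipal_char D chiD \<longrightarrow>
        real_char chiD \<longrightarrow>
        nonprincipal_char (k * D) (\<lambda>n. chik n * chiD n) \<longrightarrow>
        1 / (2 * (1 - 3 * \<gamma>)) < b \<longrightarrow>
        b < 1 / (2 * \<gamma>) \<longrightarrow>
        Re (dirichlet_L chiD 1) \<ge> c / (U powr (b * \<gamma>) * ln U ^ 3))"

definition exceptional_char :: "real \<Rightarrow> real \<Rightarrow> real \<Rightarrow> nat \<Rightarrow> (nat \<Rightarrow> complex) \<Rightarrow> bool" where
  "exceptional_char c \<gamma> b D chi \<longleftrightarrow>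
     D > 1 \<and> primitive_char D chi \<and> real_char chi \<and>
     (\<exists>\<sigma> \<in> {1 - min \<gamma> (c / (32 * ln (real D) ^ 5 * real D powr (b * \<gamma>))) .. 1}.
        dirichlet_L chi (of_real \<sigma>) = 0)"

end

theory Submission
  imports Defs "HOL-Number_Theory.Residues"
begin

text \<open>
A real zero close to 1 makes \<open>L(1, \<chi>)\<close> small, whereas a real zero of one character forces, through
the hypothesis on \<open>c\<^sub>1\<close>, the value at 1 of every other real character to be large. Let
\<open>\<chi>\<close> modulo \<open>D\<close> and \<open>\<chi>'\<close> modulo \<open>D'\<close> be distinct exceptional characters with \<open>D \<le> D'\<close> and with
zeros \<open>1 - \<delta>\<close> and \<open>1 - \<delta>'\<close>. Then
\<open>c\<^sub>1 \<le> L(1, \<chi>') (D D')\<^sup>\<beta>\<^sup>\<delta> log\<^sup>3(D D')\<close> for every admissible exponent \<open>\<beta>\<close> (\<open>deuring_real_zero\<close>),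
while \<open>L(1, \<chi>') \<le> 2 \<delta>' D'\<^sup>\<delta>\<^sup>' log\<^sup>2 D'\<close> (\<open>real_L_one_le\<close>) and \<open>\<delta>'\<close> is at most
\<open>c\<^sub>1 / (32 log\<^sup>5 D' D'\<^sup>b\<^sup>\<gamma>)\<close>. Since \<open>log (D D') \<le> 2 log D'\<close>, all of this combines to
\<open>2 \<le> D\<^sup>\<beta>\<^sup>\<delta> D'\<^sup>\<delta>\<^sup>'\<close>, up to a factor \<open>D'\<^sup>\<beta>\<^sup>\<delta> / D'\<^sup>b\<^sup>\<gamma> \<le> 1\<close>. A contradiction follows once both
\<open>\<delta> log D\<close> and \<open>\<delta>' log D'\<close> are known to be small.

That smallness (\<open>exceptional_zero_close\<close>) rests on a bound for \<open>c\<^sub>1\<close> from above, which comes from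
the hypothesis itself, applied to \<open>\<chi>\<close> together with the fixed character modulo 3, whose value at 1 is at most 1:
it gives \<open>c\<^sub>1 \<le> (3 D)\<^sup>\<beta>\<^sup>\<delta> log\<^sup>3(3 D)\<close>. Inserted into the width of the exceptional interval, this yields
\<open>\<delta> log D \<le> 3/10\<close>. The choice
\<open>\<beta> = min b 1\<close> matters: \<open>b\<close> itself can be very large, and then a bound for \<open>\<delta> log D\<close> gives none
for the factor \<open>D\<^sup>b\<^sup>\<delta>\<close>.

Three facts make the hypothesis applicable. Distinct primitive real characters have a non-principal
product (\<open>nonprincipal_product_of_distinct_primitive_chars\<close>). The zeros are different from 1, that is
\<open>L(1, \<chi>) \<noteq> 0\<close> (\<open>real_L_one_nonzero\<close>, by Monsky's Lambert series argument). The character modulo 3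
has no positive real zero (\<open>real_L_chi3_pos\<close>), so that it differs from every exceptional one.
\<close>

section \<open>Primitive characters that agree on common coprime arguments\<close>

lemma dirichlet_char_one:
  assumes "dirichlet_char k chi"
  shows "chi 1 = 1"
proof -
  have "chi (1 * 1) = chi 1 * chi 1" and "chi 1 \<noteq> 0"
    using assms unfolding dirichlet_char_def by (metis, metis coprime_1_left)
  then show ?thesis by simp
qed

lemma dirichlet_char_cong:
  assumes "dirichlet_char k chi" and "[m = n] (mod k)"
  shows "chi m = chi n"
proof -
  have shift: "chi (r + k * t) = chi r" for r t
  proof (induction t)
    case (Suc t)
    have "chi (r + k * t + k) = chi (r + k * t)"
      using assms(1) unfolding dirichlet_char_def by blast
    with Suc show ?case by (simp add: algebra_simps)
  qed simp
  have red: "chi r = chi (r mod k)" for r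
    using shift[of "r mod k" "r div k"] by simp
  show ?thesis using red[of m] red[of n] assms(2) by (simp add: cong_def)
qed

lemma dirichlet_char_power:
  assumes "dirichlet_char k chi"
  shows "chi (n ^ j) = chi n ^ j"
  using assms dirichlet_char_one[OF assms]
  by (induction j) (auto simp: dirichlet_char_def)

lemma norm_dirichlet_char_coprime:
  assumes "dirichlet_char k chi" and "coprime n k"
  shows "norm (chi n) = 1"
proof -
  have "k > 0" using assms(1) by (simp add: dirichlet_char_def)
  have "chi n ^ totient k = chi (n ^ totient k)"
    using dirichlet_char_power[OF assms(1)] by simp
  also have "\<dots> = chi 1"
    using dirichlet_char_cong[OF assms(1) euler_theorem[OF assms(2)]] by simp
  finally have "norm (chi n) ^ totient k = 1"
    using dirichlet_char_one[OF assms(1)] by (metis norm_one norm_power)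
  with \<open>k > 0\<close> show ?thesis
    using power_eq_imp_eq_base[of "norm (chi n)" "totient k" 1] by simp
qed

text \<open>
The witness is \<open>n + g t\<close>, where \<open>t\<close> is the product of the primes dividing \<open>N\<close> but not \<open>n\<close>. A prime
factor of \<open>N\<close> then divides exactly one of \<open>n\<close> and \<open>g t\<close>, because no common prime factor of \<open>N\<close> and \<open>n\<close>
divides \<open>g\<close> or \<open>t\<close>.
\<close>
lemma exists_coprime_in_residue_class:
  fixes n g N :: nat
  assumes "coprime n g" and "N > 0"
  shows "\<exists>m. [m = n] (mod g) \<and> coprime m N"
proof -
  define t where "t = \<Prod>{p. prime p \<and> p dvd N \<and> \<not> p dvd n}"
  have fin: "finite {p. prime p \<and> p dvd N \<and> \<not> p dvd n}"
    by (rule finite_subset[OF _ finite_divisors_nat[OF \<open>N > 0\<close>]]) auto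
  have "coprime (n + g * t) N"
  proof (rule ccontr)
    assume "\<not> coprime (n + g * t) N"
    then obtain p where p: "prime p" "p dvd n + g * t" "p dvd N"
      by (metis coprime_iff_gcd_eq_1 gcd_nat.bounded_iff prime_factor_nat)
    show False
    proof (cases "p dvd n")
      case True
      then have "p dvd g * t" using p(2) dvd_add_right_iff by blast
      moreover have "\<not> p dvd g"
        using True assms(1) p(1) by (meson coprime_common_divisor not_prime_unit)
      ultimately have "p dvd t" using p(1) prime_dvd_mult_iff by blast
      then obtain p' where p': "p' \<in> {p. prime p \<and> p dvd N \<and> \<not> p dvd n}" "p dvd p'"
        unfolding t_def using prime_dvd_prod_iff[OF fin p(1)] by auto
      with p(1) have "p = p'" by (simp add: primes_dvd_imp_eq)
      with p' True show False by simp
    next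
      case False
      then have "p dvd t" unfolding t_def using p fin by (intro dvd_prodI) auto
      with p(2) have "p dvd n" by (meson dvd_add_left_iff dvd_mult)
      with False show False by simp
    qed
  qed
  moreover have "[n + g * t = n] (mod g)" by (simp add: cong_def)
  ultimately show ?thesis by blast
qed

text \<open>
The Chinese remainder theorem for moduli with a common factor; a multiple of \<open>D\<close> can be congruent
modulo \<open>D'\<close> to any multiple of \<open>gcd D D'\<close>.
\<close>
lemma exists_common_residue:
  fixes m m' D D' :: nat
  assumes "[m = m'] (mod gcd D D')" and "D' > 0"
  shows "\<exists>x. [x = m] (mod D) \<and> [x = m'] (mod D')"
proof -
  obtain u where u: "[D * u = gcd D D'] (mod D')" using cong_solve_nat by blast
  have "m \<le> m' + D' * m" using \<open>D' > 0\<close> by (simp add: trans_le_add2)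
  moreover have "[m = m' + D' * m] (mod gcd D D')"
  proof -
    have "[m' + D' * m = m' + 0] (mod gcd D D')"
      by (intro cong_add cong_refl) (simp add: cong_0_iff)
    with assms(1) show ?thesis by (metis add.right_neutral cong_sym cong_trans)
  qed
  \<comment> \<open>Adding a multiple of the second modulus makes the difference a natural number.\<close>
  ultimately obtain t where t: "m' + D' * m = m + gcd D D' * t"
    by (metis cong_le_nat cong_sym mult.commute add.commute)
  have "[m + D * u * t = m + gcd D D' * t] (mod D')"
    using u by (intro cong_add cong_mult cong_refl)
  then have "[m + D * u * t = m' + D' * m] (mod D')" using t by simp
  then have "[m + D * u * t = m'] (mod D')" by (simp add: cong_def)
  moreover have "[m + D * u * t = m] (mod D)" by (simp add: cong_def mult.assoc)
  ultimately show ?thesis by blast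
qed

text \<open>
If \<open>m\<close> and \<open>m'\<close> are congruent modulo \<open>gcd D D'\<close>, some \<open>x\<close> is congruent to \<open>m\<close> modulo \<open>D\<close> and to
\<open>m'\<close> modulo \<open>D'\<close>, and \<open>chi m = chi x = chi' x = chi' m' = chi m'\<close> when all arguments are coprime to
\<open>D D'\<close>. So \<open>chi\<close> depends on the residue modulo the gcd only, and can be defined on every residue
class coprime to the gcd through a representative coprime to \<open>D D'\<close>.
\<close>
lemma agreeing_chars_induced_from_gcd:
  assumes "dirichlet_char D chi" and "dirichlet_char D' chi'"
    and agree: "\<And>n. coprime n (D * D') \<Longrightarrow> chi n = chi' n"
  shows "\<exists>\<psi>. induced_char D chi (gcd D D') \<psi>"
proof -
  define g where "g = gcd D D'"
  have pos: "D > 0" "D' > 0" using assms by (auto simp: dirichlet_char_def)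
  then have N: "D * D' > 0" by simp
  have gD: "g dvd D" "g dvd D * D'" by (auto simp: g_def)
  have eq: "chi m = chi m'"
    if m: "[m = m'] (mod g)" "coprime m (D * D')" "coprime m' (D * D')" for m m'
  proof -
    obtain x where x: "[x = m] (mod D)" "[x = m'] (mod D')"
      using exists_common_residue[of m m' D D'] m(1) pos(2) unfolding g_def by blast
    have "coprime x (D * D')"
      using x m(2,3) by (metis cong_imp_coprime cong_sym coprime_mult_right_iff)
    then have "chi m = chi' x"
      using agree dirichlet_char_cong[OF assms(1) x(1)] by simp
    also have "\<dots> = chi' m'" by (rule dirichlet_char_cong[OF assms(2) x(2)])
    finally show ?thesis using agree m(3) by simp
  qed
  define rep where "rep n = (SOME m. [m = n] (mod g) \<and> coprime m (D * D'))" for n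
  define \<psi> where "\<psi> n = (if coprime n g then chi (rep n) else 0)" for n
  have rep: "[rep n = n] (mod g) \<and> coprime (rep n) (D * D')" if "coprime n g" for n
    unfolding rep_def by (rule someI_ex[OF exists_coprime_in_residue_class[OF that N]])
  have psi: "\<psi> n = chi m" if "[m = n] (mod g)" "coprime m (D * D')" for m n
  proof -
    have cop: "coprime n g"
      using that gD(2) by (metis cong_imp_coprime coprime_divisors dvd_refl)
    then have "chi (rep n) = chi m"
      using rep[OF cop] that by (intro eq) (auto intro: cong_trans cong_sym)
    then show ?thesis using cop by (simp add: \<psi>_def)
  qed
  have "dirichlet_char g \<psi>"
    unfolding dirichlet_char_def
  proof (intro conjI allI)
    show "g > 0" using pos by (simp add: g_def)
  next
    fix m n
    show "\<psi> (m * n) = \<psi> m * \<psi> n"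
    proof (cases "coprime m g \<and> coprime n g")
      case True
      then have "\<psi> (m * n) = chi (rep m * rep n)"
        using rep[of m] rep[of n] by (intro psi cong_mult) auto
      also have "\<dots> = chi (rep m) * chi (rep n)"
        using assms(1) by (simp add: dirichlet_char_def)
      finally show ?thesis using True by (simp add: \<psi>_def)
    qed (auto simp: \<psi>_def)
  next
    fix n
    have gn: "coprime (n + g) g \<longleftrightarrow> coprime n g"
      unfolding coprime_iff_gcd_eq_1 by simp
    show "\<psi> (n + g) = \<psi> n"
    proof (cases "coprime n g")
      case True
      have "\<psi> (n + g) = chi (rep n)"
        using rep[OF True] by (intro psi) (auto simp: cong_def)
      then show ?thesis using True by (simp add: \<psi>_def)
    qed (use gn in \<open>simp add: \<psi>_def\<close>)
  next
    fix n
    show "\<psi> n = 0 \<longleftrightarrow> \<not> coprime n g"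
    proof (cases "coprime n g")
      case True
      then have "coprime (rep n) D" using rep by simp
      then show ?thesis using True assms(1) by (simp add: \<psi>_def dirichlet_char_def)
    qed (simp add: \<psi>_def)
  qed
  moreover have "chi n = \<psi> n" if n: "coprime n D" for n
  proof -
    obtain x where x: "[x = n] (mod D)" "coprime x (D * D')"
      using exists_coprime_in_residue_class[OF n N] by blast
    have "\<psi> n = chi x" using x cong_dvd_modulus_nat[OF x(1) gD(1)] by (intro psi)
    then show ?thesis using dirichlet_char_cong[OF assms(1) x(1)] by simp
  qed
  ultimately show ?thesis unfolding induced_char_def using gD by (auto simp: g_def)
qed

lemma agreeing_primitive_chars_eq:
  assumes "primitive_char D chi" and "primitive_char D' chi'"
    and agree: "\<And>n. coprime n (D * D') \<Longrightarrow> chi n = chi' n"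
  shows "D = D' \<and> chi = chi'"
proof -
  have dc: "dirichlet_char D chi" "dirichlet_char D' chi'"
    using assms by (auto simp: primitive_char_def)
  then have pos: "D > 0" "D' > 0" by (auto simp: dirichlet_char_def)
  have "\<exists>\<psi>. induced_char D chi (gcd D D') \<psi>"
    using agreeing_chars_induced_from_gcd dc agree by blast
  then have "\<not> gcd D D' < D" using assms(1) unfolding primitive_char_def by blast
  moreover have "\<exists>\<psi>. induced_char D' chi' (gcd D' D) \<psi>"
    using agreeing_chars_induced_from_gcd[OF dc(2,1)] agree by (simp add: mult.commute)
  then have "\<not> gcd D' D < D'" using assms(2) unfolding primitive_char_def by blast
  ultimately have "gcd D D' = D" "gcd D D' = D'"
    using pos by (metis gcd_le1_nat gcd_le2_nat le_neq_implies_less not_gr_zero gcd.commute)+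
  then have "D = D'" by simp
  moreover have "chi n = chi' n" for n
  proof (cases "coprime n D")
    case True
    then show ?thesis using agree[of n] \<open>D = D'\<close> by simp
  next
    case False
    then have "chi n = 0" "chi' n = 0"
      using dc \<open>D = D'\<close> unfolding dirichlet_char_def by blast+
    then show ?thesis by simp
  qed
  ultimately show ?thesis by auto
qed

lemma primitive_char_imp_nonprincipal:
  assumes "primitive_char D chi" and "D > 1"
  shows "nonprincipal_char D chi"
proof -
  have "induced_char D (principal_char D) 1 (\<lambda>_. 1)"
    by (simp add: induced_char_def dirichlet_char_def principal_char_def)
  then show ?thesis using assms unfolding primitive_char_def nonprincipal_char_def by blast
qed

lemma nonprincipal_char_witness:
  assumes "nonprincipal_char D chi"
  obtains a where "coprime a D" "chi a \<noteq> 1"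
  using assms unfolding nonprincipal_char_def principal_char_def dirichlet_char_def
  by (metis ext)

lemma nonprincipal_char_modulus_ge_3:
  assumes "nonprincipal_char D chi"
  shows "D \<ge> 3"
proof (rule ccontr)
  assume "\<not> D \<ge> 3"
  have dc: "dirichlet_char D chi" using assms by (simp add: nonprincipal_char_def)
  then have "D > 0" by (simp add: dirichlet_char_def)
  with \<open>\<not> D \<ge> 3\<close> consider "D = 1" | "D = 2" by linarith
  then have "[a = 1] (mod D)" if "coprime a D" for a
    using that by cases (auto simp: cong_def odd_iff_mod_2_eq_one coprime_right_2_iff_odd)
  then have "chi a = 1" if "coprime a D" for a
    using dirichlet_char_cong[OF dc] dirichlet_char_one[OF dc] that by metis
  then show False using nonprincipal_char_witness[OF assms] by metis
qed

text \<open>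
A real character is its own inverse on its coprime arguments, so a principal product would mean
that the two characters agree there.
\<close>
lemma nonprincipal_product_of_distinct_primitive_chars:
  assumes "primitive_char D chi" and "primitive_char D' chi'" and "real_char chi'"
    and "\<not> (D = D' \<and> chi = chi')"
  shows "nonprincipal_char (D * D') (\<lambda>n. chi n * chi' n)"
proof -
  have dc: "dirichlet_char D chi" "dirichlet_char D' chi'"
    using assms by (auto simp: primitive_char_def)
  have per: "chi (n + D * D') = chi n" "chi' (n + D * D') = chi' n" for n
    using dirichlet_char_cong[OF dc(1), of "n + D * D'" n]
      dirichlet_char_cong[OF dc(2), of "n + D * D'" n] by (auto simp: cong_def)
  have dcp: "dirichlet_char (D * D') (\<lambda>n. chi n * chi' n)"
    using dc per unfolding dirichlet_char_def by auto
  moreover have "(\<lambda>n. chi n * chi' n) \<noteq> principal_char (D * D')"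
  proof
    assume prin: "(\<lambda>n. chi n * chi' n) = principal_char (D * D')"
    have "chi n = chi' n" if "coprime n (D * D')" for n
    proof -
      have one: "chi n * chi' n = 1"
        using fun_cong[OF prin, of n] that by (simp add: principal_char_def)
      obtain r where r: "chi' n = complex_of_real r"
        using assms(3) unfolding real_char_def by (meson Reals_cases)
      have "norm (chi' n) = 1" using norm_dirichlet_char_coprime[OF dc(2)] that by simp
      then have "chi' n * chi' n = 1"
        unfolding r by (simp flip: of_real_mult) (metis abs_mult_self_eq mult_1 of_real_1)
      with one show ?thesis by (metis mult.assoc mult.left_neutral mult.right_neutral)
    qed
    then show False using agreeing_primitive_chars_eq assms by blast
  qed
  ultimately show ?thesis by (simp add: nonprincipal_char_def)
qed

section \<open>Abel summation and real $L$-series\<close>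

lemma abel_summation_bound:
  fixes a h :: "nat \<Rightarrow> real"
  assumes B: "\<And>m. \<bar>\<Sum>i<m. a i\<bar> \<le> B"
    and decr: "\<And>n. h (Suc n) \<le> h n" and nonneg: "\<And>n. 0 \<le> h n"
  shows "\<bar>\<Sum>i<N. a i * h i\<bar> \<le> B * h 0"
proof -
  define A where "A m = (\<Sum>i<m. a i)" for m
  have "(\<Sum>i<N. a i * h i) = A N * h N + (\<Sum>i<N. A (Suc i) * (h i - h (Suc i)))" for N
    by (induction N) (auto simp: A_def algebra_simps)
  then have "\<bar>\<Sum>i<N. a i * h i\<bar> \<le> \<bar>A N * h N\<bar> + \<bar>\<Sum>i<N. A (Suc i) * (h i - h (Suc i))\<bar>"
    by (simp only: abs_triangle_ineq)
  also have "\<bar>A N * h N\<bar> \<le> B * h N"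
    using B[of N] nonneg[of N] by (simp add: A_def abs_mult mult_right_mono)
  also have "\<bar>\<Sum>i<N. A (Suc i) * (h i - h (Suc i))\<bar> \<le> (\<Sum>i<N. B * (h i - h (Suc i)))"
  proof (rule sum_abs[THEN order_trans], rule sum_mono)
    fix i
    show "\<bar>A (Suc i) * (h i - h (Suc i))\<bar> \<le> B * (h i - h (Suc i))"
      using B[of "Suc i"] decr[of i] unfolding A_def abs_mult
      by (intro mult_mono) auto
  qed
  also have "B * h N + (\<Sum>i<N. B * (h i - h (Suc i))) = B * h 0"
    by (induction N) (auto simp: algebra_simps)
  finally show ?thesis by simp
qed

lemma abel_summable:
  fixes a h :: "nat \<Rightarrow> real"
  assumes B: "\<And>M m. \<bar>\<Sum>i<m. a (M + i)\<bar> \<le> B"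
    and decr: "\<And>n. h (Suc n) \<le> h n" and lim: "h \<longlonglongrightarrow> 0"
  shows "summable (\<lambda>n. a n * h n)"
proof (rule summable_bounded_partials)
  have nonneg: "0 \<le> h n" for n
    using decseq_ge[OF decseq_SucI lim] decr by blast
  show "eventually (\<lambda>x0. \<forall>x\<ge>x0. \<forall>y>x. norm (\<Sum>n\<in>{x<..y}. a n * h n) \<le> B * h (Suc x)) sequentially"
  proof (intro always_eventually allI impI)
    fix x y :: nat assume "x < y"
    have "(\<Sum>n\<in>{x<..y}. a n * h n) = (\<Sum>i<y - x. a (Suc x + i) * h (Suc x + i))"
      by (rule sum.reindex_bij_witness[of _ "\<lambda>i. Suc x + i" "\<lambda>n. n - Suc x"]) auto
    also have "\<bar>\<dots>\<bar> \<le> B * h (Suc x + 0)"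
      by (rule abel_summation_bound) (use B[of "Suc x"] decr nonneg in auto)
    finally show "norm (\<Sum>n\<in>{x<..y}. a n * h n) \<le> B * h (Suc x)" by simp
  qed
  show "(\<lambda>x. B * h (Suc x)) \<longlonglongrightarrow> 0"
    using tendsto_mult_right_zero[OF LIMSEQ_Suc[OF lim]] by simp
qed

lemma abel_suminf_bound:
  fixes a h :: "nat \<Rightarrow> real"
  assumes B: "\<And>M m. \<bar>\<Sum>i<m. a (M + i)\<bar> \<le> B"
    and decr: "\<And>n. h (Suc n) \<le> h n" and lim: "h \<longlonglongrightarrow> 0"
  shows "\<bar>\<Sum>n. a n * h n\<bar> \<le> B * h 0"
proof (rule LIMSEQ_le_const2)
  have nonneg: "0 \<le> h n" for n
    using decseq_ge[OF decseq_SucI lim] decr by blast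
  show "(\<lambda>N. \<bar>\<Sum>n<N. a n * h n\<bar>) \<longlonglongrightarrow> \<bar>\<Sum>n. a n * h n\<bar>"
    using abel_summable[OF assms] by (intro tendsto_rabs summable_LIMSEQ)
  show "\<exists>N. \<forall>n\<ge>N. \<bar>\<Sum>n<n. a n * h n\<bar> \<le> B * h 0"
  proof (intro exI allI impI)
    fix N
    show "\<bar>\<Sum>n<N. a n * h n\<bar> \<le> B * h 0"
    proof (rule abel_summation_bound)
      show "\<bar>\<Sum>i<m. a i\<bar> \<le> B" for m using B[of 0 m] by simp
      show "h (Suc n) \<le> h n" for n by (rule decr)
      show "0 \<le> h n" for n by (rule nonneg)
    qed
  qed
qed

lemma powr_minus_tendsto_0:
  assumes "s > (0 :: real)"
  shows "(\<lambda>n. real (Suc n) powr (- s)) \<longlonglongrightarrow> 0"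
proof -
  have "(\<lambda>n. real n powr (- s)) \<longlonglongrightarrow> 0"
    by (rule tendsto_neg_powr[OF _ filterlim_real_sequentially]) (use assms in simp)
  then show ?thesis by (rule LIMSEQ_Suc)
qed

lemma powr_minus_decreasing:
  assumes "s > (0 :: real)"
  shows "real (Suc (Suc n)) powr (- s) \<le> real (Suc n) powr (- s)"
proof -
  have "- s \<le> 0" using assms by linarith
  moreover have "0 < real (Suc n)" by simp
  moreover have "real (Suc n) \<le> real (Suc (Suc n))" by linarith
  ultimately show ?thesis by (rule powr_mono2')
qed

text \<open>
The \<open>n\<close>-th term is written as a product with \<open>n powr (- s)\<close> because Abel summation is stated for products.
\<close>
definition real_L :: "(nat \<Rightarrow> real) \<Rightarrow> real \<Rightarrow> real" where
  "real_L f s = (\<Sum>n. f (Suc n) * real (Suc n) powr (- s))"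

text \<open>
The real parts of a real non-principal character modulo \<open>q\<close>. The analytic part of the proof
takes place over the real numbers, which have the order that Abel summation and the positivity of
divisor sums rely on.
\<close>
locale nonprincipal_quadratic_char =
  fixes q :: nat and f :: "nat \<Rightarrow> real"
  assumes q_pos: "q > 0"
    and mult: "f (m * n) = f m * f n"
    and cong: "[m = n] (mod q) \<Longrightarrow> f m = f n"
    and quadratic_values: "f n \<in> {-1, 0, 1}"
    and one: "f 1 = 1"
    and nonprincipal: "\<exists>a. coprime a q \<and> f a \<noteq> 1"
begin

lemma abs_le_1: "\<bar>f n\<bar> \<le> 1"
  using quadratic_values[of n] by auto

text \<open>
Multiplication by \<open>a\<close> permutes the residues, so it multiplies the sum over a period by
\<open>f a \<noteq> 1\<close> without changing it.
\<close>
lemma sum_period: "(\<Sum>i<q. f (M + i)) = 0"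
proof (induction M)
  case 0
  obtain a where a: "coprime a q" "f a \<noteq> 1" using nonprincipal by blast
  have inj: "inj_on (\<lambda>i. (a * i) mod q) {..<q}"
  proof (rule inj_onI)
    fix i j assume ij: "i \<in> {..<q}" "j \<in> {..<q}" "(a * i) mod q = (a * j) mod q"
    then have "[a * i = a * j] (mod q)" by (simp add: cong_def)
    then have "[i = j] (mod q)" using a(1) cong_mult_lcancel_nat by blast
    then show "i = j" using ij by (simp add: cong_def)
  qed
  have "(\<lambda>i. (a * i) mod q) ` {..<q} = {..<q}"
    using q_pos inj by (intro card_subset_eq) (auto simp: card_image)
  then have bij: "bij_betw (\<lambda>i. (a * i) mod q) {..<q} {..<q}"
    using inj by (simp add: bij_betw_def)
  have "f a * (\<Sum>i<q. f i) = (\<Sum>i<q. f ((a * i) mod q))"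
    unfolding sum_distrib_left mult[symmetric] by (intro sum.cong cong) (auto simp: cong_def)
  also have "\<dots> = (\<Sum>i<q. f i)" by (rule sum.reindex_bij_betw[OF bij])
  finally show ?case using a(2) by simp
next
  case (Suc M)
  have "(\<Sum>i<q. f (Suc M + i)) + f M = (\<Sum>i<Suc q. f (M + i))"
    by (simp add: sum.lessThan_Suc_shift del: sum.lessThan_Suc)
  also have "\<dots> = (\<Sum>i<q. f (M + i)) + f (M + q)" by simp
  also have "f (M + q) = f M" by (rule cong) (simp add: cong_def)
  finally show ?case using Suc by simp
qed

lemma abs_sum_le_modulus: "\<bar>\<Sum>i<m. f (M + i)\<bar> \<le> q"
proof (induction m arbitrary: M rule: less_induct)
  case (less m)
  show ?case
  proof (cases "m < q")
    case True
    have "\<bar>\<Sum>i<m. f (M + i)\<bar> \<le> (\<Sum>i<m. 1)"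
      using abs_le_1 by (intro sum_abs[THEN order_trans] sum_mono) auto
    then show ?thesis using True by simp
  next
    case False
    then obtain k where k: "m = q + k" using le_Suc_ex not_less by blast
    have "(\<Sum>i<q + k. f (M + i)) = (\<Sum>i<q. f (M + i)) + (\<Sum>i<k. f (M + q + i))"
      by (induction k) (auto simp: add.assoc)
    then show ?thesis using less[of k "M + q"] k q_pos sum_period by simp
  qed
qed

lemma abs_sum_Suc_le_modulus: "\<bar>\<Sum>i<m. f (Suc (M + i))\<bar> \<le> q"
  using abs_sum_le_modulus[of "Suc M" m] by simp

lemma summable_real_L:
  assumes "s > 0"
  shows "summable (\<lambda>n. f (Suc n) * real (Suc n) powr (- s))"
proof (rule abel_summable[where a = "\<lambda>n. f (Suc n)" and B = "real q"
      and h = "\<lambda>n. real (Suc n) powr (- s)"])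
  show "\<bar>\<Sum>i<m. f (Suc (M + i))\<bar> \<le> real q" for M m
    using abs_sum_Suc_le_modulus[of M m] .
  show "real (Suc (Suc n)) powr (- s) \<le> real (Suc n) powr (- s)" for n
    using powr_minus_decreasing[OF assms] .
  show "(\<lambda>n. real (Suc n) powr (- s)) \<longlonglongrightarrow> 0"
    using powr_minus_tendsto_0[OF assms] .
qed

end

section \<open>Non-vanishing at the point 1\<close>

definition divisor_sum :: "(nat \<Rightarrow> real) \<Rightarrow> nat \<Rightarrow> real" where
  "divisor_sum f m = (\<Sum>d | d dvd m. f d)"

lemma divisors_prime_power_mult:
  fixes p m k :: nat
  assumes "prime p"
  shows "{d. d dvd p ^ k * m} = (\<lambda>(i, d). p ^ i * d) ` ({..k} \<times> {d. d dvd m})"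
proof (intro equalityI subsetI)
  fix d assume "d \<in> {d. d dvd p ^ k * m}"
  then obtain b c where "d = b * c" "b dvd p ^ k" "c dvd m"
    using division_decomp[of d "p ^ k" m] by auto
  then show "d \<in> (\<lambda>(i, d). p ^ i * d) ` ({..k} \<times> {d. d dvd m})"
    using divides_primepow_nat[OF assms] by auto
qed (auto intro: mult_dvd_mono le_imp_power_dvd)

lemma inj_on_prime_power_mult:
  fixes p m k :: nat
  assumes "prime p" and "\<not> p dvd m"
  shows "inj_on (\<lambda>(i, d). p ^ i * d) ({..k} \<times> {d. d dvd m})"
proof -
  have mul: "multiplicity p (p ^ i * d) = i" if "d dvd m" for i d
  proof -
    have "\<not> p dvd d" using assms(2) that dvd_trans by blast
    then show ?thesis
      using assms(1) by (intro multiplicity_eqI) (auto simp: prime_gt_0_nat)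
  qed
  show ?thesis
  proof (rule inj_onI, clarify)
    fix i d j e assume "d dvd m" "e dvd m" "p ^ i * d = p ^ j * e"
    moreover from this have "i = j" using mul by metis
    ultimately show "i = j \<and> d = e" using assms(1) by (simp add: prime_gt_0_nat)
  qed
qed

context nonprincipal_quadratic_char
begin

lemma power: "f (n ^ j) = f n ^ j"
  using one by (induction j) (auto simp: mult)

lemma divisor_sum_prime_power_mult:
  assumes "prime p" and "\<not> p dvd m"
  shows "divisor_sum f (p ^ k * m) = (\<Sum>i\<le>k. f p ^ i) * divisor_sum f m"
proof -
  have "divisor_sum f (p ^ k * m) = (\<Sum>(i, d)\<in>{..k} \<times> {d. d dvd m}. f (p ^ i * d))"
    unfolding divisor_sum_def divisors_prime_power_mult[OF assms(1)]
      sum.reindex[OF inj_on_prime_power_mult[OF assms]]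
    by (simp add: case_prod_unfold)
  also have "\<dots> = (\<Sum>i\<le>k. f p ^ i) * divisor_sum f m"
    by (simp add: divisor_sum_def mult power sum_product sum.cartesian_product)
  finally show ?thesis .
qed

lemma geometric_sum_nonneg:
  shows "(\<Sum>i\<le>k. f p ^ i) \<ge> 0" and "even k \<Longrightarrow> (\<Sum>i\<le>k. f p ^ i) \<ge> 1"
proof -
  have "(\<Sum>i\<le>k. (-1 :: real) ^ i) = (if even k then 1 else 0)"
    by (induction k) auto
  moreover have "(\<Sum>i\<le>k. (0 :: real) ^ i) = 1" by (induction k) auto
  ultimately show "(\<Sum>i\<le>k. f p ^ i) \<ge> 0" and "even k \<Longrightarrow> (\<Sum>i\<le>k. f p ^ i) \<ge> 1"
    using quadratic_values[of p] by auto
qed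

text \<open>
The divisor sum is the coefficient of \<open>m\<close> in \<open>\<zeta>(s) L(s, f)\<close>. It is multiplicative and its factor at
a prime power \<open>p ^ k\<close> is \<open>1 + f p + \<dots> + f p ^ k\<close>, which is nonnegative and at least 1 for even \<open>k\<close>.
\<close>
lemma divisor_sum_nonneg_and_square:
  assumes "m > 0"
  shows "divisor_sum f m \<ge> 0 \<and> ((\<exists>j. m = j\<^sup>2) \<longrightarrow> divisor_sum f m \<ge> 1)"
  using assms
proof (induction m rule: less_induct)
  case (less m)
  show ?case
  proof (cases "m = 1")
    case True
    then show ?thesis using one by (simp add: divisor_sum_def)
  next
    case False
    then obtain p where p: "prime p" "p dvd m" using prime_factor_nat by blast
    define k where "k = multiplicity p m"
    obtain m' where m': "m = p ^ k * m'" "\<not> p dvd m'"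
      using less.prems p(1) unfolding k_def
      by (metis multiplicity_decompose' not_prime_unit less_numeral_extra(3))
    have "m' > 0" using m' less.prems by (intro Nat.gr0I) auto
    moreover have "k \<noteq> 0" using m' p(2) by (intro notI) auto
    then have "1 < p ^ k" using p(1) prime_gt_1_nat by (intro one_less_power) auto
    then have "m' < m" using m'(1) \<open>m' > 0\<close> by simp
    ultimately have IH: "divisor_sum f m' \<ge> 0" "(\<exists>j. m' = j\<^sup>2) \<Longrightarrow> divisor_sum f m' \<ge> 1"
      using less.IH by auto
    have eq: "divisor_sum f m = (\<Sum>i\<le>k. f p ^ i) * divisor_sum f m'"
      using divisor_sum_prime_power_mult[OF p(1) m'(2)] m'(1) by simp
    have "divisor_sum f m \<ge> 1" if "m = j\<^sup>2" for j
    proof -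
      have "j > 0" using that less.prems by (intro Nat.gr0I) auto
      then obtain l j' where j': "j = p ^ l * j'" "\<not> p dvd j'"
        using p(1) by (metis multiplicity_decompose' not_prime_unit less_numeral_extra(3))
      have m2: "m = p ^ (2 * l) * j'\<^sup>2"
        using that j' by (simp add: power_mult_distrib power_mult mult.commute)
      have "\<not> p dvd j'\<^sup>2" using j'(2) p(1) prime_dvd_power by blast
      then have "k = 2 * l"
        unfolding k_def m2 using p(1) by (intro multiplicity_eqI) (auto simp: prime_gt_0_nat)
      moreover from this have "m' = j'\<^sup>2"
        using m2 m'(1) p(1) by (simp add: prime_gt_0_nat)
      ultimately have "1 * 1 \<le> (\<Sum>i\<le>k. f p ^ i) * divisor_sum f m'"
        using geometric_sum_nonneg(2)[of k p] IH(2)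
        by (intro mult_mono) auto
      then show ?thesis using eq by simp
    qed
    then show ?thesis using eq IH(1) geometric_sum_nonneg(1) by auto
  qed
qed

end

lemma sum_divisors_swap:
  fixes g :: "nat \<Rightarrow> nat \<Rightarrow> real"
  shows "(\<Sum>m=1..M. \<Sum>d | d dvd m. g d m) = (\<Sum>n=1..M. \<Sum>k=1..M div n. g n (n * k))"
proof -
  have div_range: "b > 0 \<and> b \<le> M" if "b dvd a" "0 < a" "a \<le> M" for a b :: nat
    using that dvd_imp_le[of b a] by (auto intro: Nat.gr0I)
  have "(\<Sum>m=1..M. \<Sum>d | d dvd m. g d m) = (\<Sum>(m, d)\<in>(SIGMA m:{1..M}. {d. d dvd m}). g d m)"
    by (intro sum.Sigma) auto
  also have "\<dots> = (\<Sum>(n, k)\<in>(SIGMA n:{1..M}. {1..M div n}). g n (n * k))"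
    using div_range by (intro sum.reindex_bij_witness[of _ "\<lambda>(n, k). (n * k, n)" "\<lambda>(m, d). (d, m div d)"])
       (auto simp: div_le_mono Suc_le_eq less_eq_div_iff_mult_less_eq mult.commute
         dest: dvd_imp_le)
  also have "\<dots> = (\<Sum>n=1..M. \<Sum>k=1..M div n. g n (n * k))"
    by (intro sum.Sigma[symmetric]) auto
  finally show ?thesis .
qed

definition geom_sum :: "real \<Rightarrow> nat \<Rightarrow> real" where
  "geom_sum x n = (\<Sum>i<n. x ^ i)"

text \<open>
Summed against a character, the second term gives the Lambert series, which is the power series of the divisor
sums; the first gives \<open>L(1) / (1 - x)\<close>. The point of the difference is that it decreases
in \<open>n\<close> from the value 1 at \<open>n = 1\<close>, for every \<open>x\<close> between 0 and 1.
\<close>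
definition lambert_weight :: "real \<Rightarrow> nat \<Rightarrow> real" where
  "lambert_weight x n = 1 / (real n * (1 - x)) - x ^ n / (1 - x ^ n)"

lemma geom_sum_pos: "0 < x \<Longrightarrow> 0 < n \<Longrightarrow> geom_sum x n > 0"
  unfolding geom_sum_def by (intro sum_pos) auto

text \<open>
The arithmetic mean of the terms \<open>y\<^sup>2\<^sup>i\<close> and \<open>y\<^sup>2\<^sup>(\<^sup>n\<^sup>-\<^sup>i\<^sup>)\<close> is at least \<open>y\<^sup>n\<close>. Squares are used as the
base so that this geometric mean is a power with a natural exponent.
\<close>
lemma geom_sum_square_ge:
  assumes "0 \<le> (y :: real)"
  shows "geom_sum (y\<^sup>2) (Suc n) \<ge> real (Suc n) * y ^ n"
proof -
  have "2 * (real (Suc n) * y ^ n) = (\<Sum>i\<le>n. 2 * y ^ n)" by simp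
  also have "\<dots> \<le> (\<Sum>i\<le>n. (y\<^sup>2) ^ i + (y\<^sup>2) ^ (n - i))"
  proof (rule sum_mono)
    fix i assume "i \<in> {..n}"
    then have "2 * y ^ n = 2 * y ^ i * y ^ (n - i)" by (simp flip: power_add)
    also have "\<dots> \<le> (y ^ i)\<^sup>2 + (y ^ (n - i))\<^sup>2" by (rule sum_squares_bound)
    finally show "2 * y ^ n \<le> (y\<^sup>2) ^ i + (y\<^sup>2) ^ (n - i)"
      by (simp flip: power_mult add: mult.commute)
  qed
  also have "\<dots> = 2 * geom_sum (y\<^sup>2) (Suc n)"
    unfolding geom_sum_def lessThan_Suc_atMost sum.distrib
    using sum.nat_diff_reindex[of "\<lambda>i. (y\<^sup>2) ^ i" "Suc n"]
    by (simp add: lessThan_Suc_atMost)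
  finally show ?thesis by simp
qed

text \<open>
With \<open>x = y\<^sup>2\<close> and \<open>s\<^sub>n = 1 + x + \<dots> + x\<^sup>n\<^sup>-\<^sup>1\<close>, the weight is \<open>(1/n - x\<^sup>n / s\<^sub>n) / (1 - x)\<close>. As
\<open>s\<^sub>n\<^sub>+\<^sub>1 = 1 + x s\<^sub>n\<close>, consecutive weights decrease exactly if \<open>n (n + 1) x\<^sup>n \<le> s\<^sub>n s\<^sub>n\<^sub>+\<^sub>1\<close>, which follows
from the inequality of the means for the two geometric sums.
\<close>
lemma lambert_weight_decreasing:
  assumes "0 < y" "y < 1" and "n > 0"
  shows "lambert_weight (y\<^sup>2) (Suc n) \<le> lambert_weight (y\<^sup>2) n"
proof -
  define x where "x = y\<^sup>2"
  have x: "0 < x" "x < 1" using assms by (auto simp: x_def power_less_one_iff abs_square_less_1)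
  obtain k where k: "n = Suc k" using assms(3) gr0_implies_Suc by blast
  define s where "s = geom_sum x n"
  define s' where "s' = geom_sum x (Suc n)"
  have pos: "s > 0" "s' > 0" unfolding s_def s'_def using x assms(3) by (auto intro: geom_sum_pos)
  have rec: "s' = 1 + x * s"
    unfolding s_def s'_def geom_sum_def
    by (simp add: sum.lessThan_Suc_shift sum_distrib_left del: sum.lessThan_Suc)
  have geo: "1 - x ^ m = (1 - x) * geom_sum x m" for m
    unfolding geom_sum_def using x by (simp add: one_diff_power_eq)
  have "real n * y ^ k * (real (Suc n) * y ^ n) \<le> s * s'"
    unfolding s_def s'_def x_def k using assms pos
    by (intro mult_mono geom_sum_square_ge mult_nonneg_nonneg)
       (auto intro!: geom_sum_pos[THEN less_imp_le])
  moreover have "x ^ n \<le> y ^ k * y ^ n"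
  proof -
    have "y ^ (2 * n) \<le> y ^ (k + n)" using assms k by (intro power_decreasing) auto
    then show ?thesis by (simp only: x_def power_mult power_add)
  qed
  then have "real n * real (Suc n) * x ^ n \<le> real n * real (Suc n) * (y ^ k * y ^ n)"
    by (intro mult_left_mono) auto
  ultimately have key: "real n * real (Suc n) * x ^ n \<le> s * s'"
    by (simp add: algebra_simps)
  have "x ^ n / s - x ^ Suc n / s' = x ^ n * (s' - x * s) / (s * s')"
    using pos by (simp add: field_simps)
  also have "\<dots> = x ^ n / (s * s')" using rec by simp
  also have "\<dots> \<le> 1 / (real n * real (Suc n))"
    using key pos assms(3) by (simp add: divide_simps mult.commute)
  also have "\<dots> = 1 / real n - 1 / real (Suc n)"
    using assms(3) by (simp add: field_simps)
  finally have "1 / real (Suc n) - x ^ Suc n / s' \<le> 1 / real n - x ^ n / s" by simp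
  then have "(1 / real (Suc n) - x ^ Suc n / s') / (1 - x) \<le> (1 / real n - x ^ n / s) / (1 - x)"
    using x by (intro divide_right_mono) auto
  then show ?thesis
    unfolding lambert_weight_def x_def[symmetric] geo s_def[symmetric] s'_def[symmetric]
    by (simp add: diff_divide_distrib mult.commute)
qed

lemma lambert_weight_nonneg:
  assumes "0 < x" "x < 1" and "n > 0"
  shows "0 \<le> lambert_weight x n"
proof -
  have "real n * x ^ n = (\<Sum>i<n. x ^ n)" by simp
  also have "\<dots> \<le> geom_sum x n"
    unfolding geom_sum_def using assms by (intro sum_mono power_decreasing) auto
  finally have "x ^ n / geom_sum x n \<le> 1 / real n"
    using geom_sum_pos[of x n] assms by (simp add: field_simps)
  then have "x ^ n / geom_sum x n / (1 - x) \<le> 1 / real n / (1 - x)"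
    using assms by (intro divide_right_mono) auto
  moreover have "1 - x ^ n = (1 - x) * geom_sum x n"
    unfolding geom_sum_def using assms by (simp add: one_diff_power_eq)
  ultimately show ?thesis unfolding lambert_weight_def by (simp add: mult.commute)
qed

context nonprincipal_quadratic_char
begin

lemma abs_sum_lambert_weight_le:
  assumes "0 < y" "y < 1"
  shows "\<bar>\<Sum>n=1..M. f n * lambert_weight (y\<^sup>2) n\<bar> \<le> q"
proof -
  have y2: "0 < y\<^sup>2" "y\<^sup>2 < 1" using assms by (auto simp: abs_square_less_1)
  have "(\<Sum>n=1..M. f n * lambert_weight (y\<^sup>2) n) = (\<Sum>i<M. f (Suc i) * lambert_weight (y\<^sup>2) (Suc i))"
    by (rule sum.reindex_bij_witness[of _ Suc "\<lambda>n. n - 1"]) auto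
  also have "\<bar>\<dots>\<bar> \<le> real q * lambert_weight (y\<^sup>2) (Suc 0)"
    using abs_sum_Suc_le_modulus[of 0] assms y2
    by (intro abel_summation_bound lambert_weight_decreasing lambert_weight_nonneg) auto
  also have "lambert_weight (y\<^sup>2) (Suc 0) = 1"
    using y2 by (simp add: lambert_weight_def flip: diff_divide_distrib)
  finally show ?thesis by simp
qed

text \<open>
For finite sums, expanding \<open>x\<^sup>n / (1 - x\<^sup>n)\<close> as a geometric series and exchanging the summations leaves for each \<open>n\<close>
only the terms with exponent above \<open>M\<close>, a geometric tail.
\<close>
lemma truncated_lambert_series:
  assumes "0 < x" "x < 1"
  shows "\<bar>(\<Sum>m=1..M. divisor_sum f m * x ^ m) - (\<Sum>n=1..M. f n * (x ^ n / (1 - x ^ n)))\<bar>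
    \<le> real M * x ^ M / (1 - x)"
proof -
  have inner: "\<bar>(\<Sum>k=1..M div n. x ^ (n * k)) - x ^ n / (1 - x ^ n)\<bar> \<le> x ^ M / (1 - x)"
    if n: "n \<in> {1..M}" for n
  proof -
    define z where "z = x ^ n"
    define K where "K = M div n"
    have z: "0 < z" "z \<le> x"
      using assms n power_decreasing[of 1 n x] by (auto simp: z_def)
    have geo: "(\<Sum>k=1..K. z ^ k) = (z - z ^ Suc K) / (1 - z)"
    proof -
      have "(1 - z) * (\<Sum>k=1..K. z ^ k) = z - z ^ Suc K"
      proof (induction K)
        case (Suc K)
        then show ?case by (simp add: distrib_left) (simp add: left_diff_distrib)
      qed simp
      then show ?thesis using z assms by (simp add: field_simps)
    qed
    \<comment> \<open>The first omitted exponent \<open>n (K + 1)\<close> exceeds \<open>M\<close>.\<close>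
    have "z ^ Suc K = x ^ (n * Suc K)" by (simp only: z_def power_mult)
    also have "\<dots> \<le> x ^ M"
    proof (rule power_decreasing)
      have "M = n * K + M mod n" by (simp add: K_def)
      moreover have "M mod n < n" using n by simp
      ultimately show "M \<le> n * Suc K" by simp
    qed (use assms in auto)
    finally have le: "z ^ Suc K \<le> x ^ M" .
    have "(\<Sum>k=1..M div n. x ^ (n * k)) - x ^ n / (1 - x ^ n) = - (z ^ Suc K / (1 - z))"
      using geo unfolding K_def[symmetric] power_mult z_def[symmetric]
      by (simp add: diff_divide_distrib)
    also have "\<bar>\<dots>\<bar> = z ^ Suc K / (1 - z)" using z assms by simp
    also have "\<dots> \<le> x ^ M / (1 - x)"
      using le z assms by (intro frac_le) auto
    finally show ?thesis .
  qed
  have "(\<Sum>m=1..M. divisor_sum f m * x ^ m) = (\<Sum>n=1..M. f n * (\<Sum>k=1..M div n. x ^ (n * k)))"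
    using sum_divisors_swap[of "\<lambda>d m. f d * x ^ m" M]
    by (simp add: divisor_sum_def sum_distrib_left sum_distrib_right)
  then have "(\<Sum>m=1..M. divisor_sum f m * x ^ m) - (\<Sum>n=1..M. f n * (x ^ n / (1 - x ^ n)))
    = (\<Sum>n=1..M. f n * ((\<Sum>k=1..M div n. x ^ (n * k)) - x ^ n / (1 - x ^ n)))"
    by (simp add: sum_subtractf right_diff_distrib)
  also have "\<bar>\<dots>\<bar> \<le> (\<Sum>n=1..M. 1 * (x ^ M / (1 - x)))"
  proof (rule sum_abs[THEN order_trans], rule sum_mono)
    fix n assume "n \<in> {1..M}"
    then show "\<bar>f n * ((\<Sum>k=1..M div n. x ^ (n * k)) - x ^ n / (1 - x ^ n))\<bar>
        \<le> 1 * (x ^ M / (1 - x))"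
      unfolding abs_mult by (intro mult_mono abs_le_1 inner) auto
  qed
  finally show ?thesis by simp
qed

lemma sum_squares_le_lambert:
  assumes "0 < x" and "J\<^sup>2 \<le> M"
  shows "(\<Sum>j=1..J. x ^ (j\<^sup>2)) \<le> (\<Sum>m=1..M. divisor_sum f m * x ^ m)"
proof -
  have "(\<Sum>j=1..J. x ^ (j\<^sup>2)) \<le> (\<Sum>j=1..J. divisor_sum f (j\<^sup>2) * x ^ (j\<^sup>2))"
    using assms divisor_sum_nonneg_and_square by (intro sum_mono) auto
  also have "\<dots> = (\<Sum>m\<in>(\<lambda>j. j\<^sup>2) ` {1..J}. divisor_sum f m * x ^ m)"
    by (subst sum.reindex) (auto simp: inj_on_def)
  also have "\<dots> \<le> (\<Sum>m=1..M. divisor_sum f m * x ^ m)"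
  proof (rule sum_mono2)
    show "(\<lambda>j. j\<^sup>2) ` {1..J} \<subseteq> {1..M}"
      using assms(2) by (auto intro: order_trans[OF power_mono])
  qed (use assms divisor_sum_nonneg_and_square in auto)
  finally show ?thesis .
qed

text \<open>
Monsky's proof of Dirichlet's theorem. If \<open>L(1) = 0\<close>, the Lambert series of \<open>f\<close> equals minus the sum of
\<open>f\<close> against \<open>lambert_weight\<close>, which Abel summation bounds by the weight 1 at \<open>n = 1\<close> times \<open>q\<close>. But the
Lambert series dominates the sum of \<open>x\<close> raised to the squares, which is unbounded as \<open>x\<close> tends to 1: \<open>q + 1\<close>
squares suffice for a contradiction.
\<close>
theorem real_L_one_nonzero: "real_L f 1 \<noteq> 0"
proof
  assume zero: "real_L f 1 = 0"
  have "(\<lambda>M. \<Sum>i<M. f (Suc i) * real (Suc i) powr (- 1)) \<longlonglongrightarrow> real_L f 1"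
    unfolding real_L_def by (rule summable_LIMSEQ[OF summable_real_L]) simp
  moreover have "(\<Sum>i<M. f (Suc i) * real (Suc i) powr (- 1)) = (\<Sum>n=1..M. f n / n)" for M
    by (rule sum.reindex_bij_witness[of _ "\<lambda>n. n - 1" Suc])
       (auto simp: powr_minus divide_simps)
  ultimately have L: "(\<lambda>M. \<Sum>n=1..M. f n / n) \<longlonglongrightarrow> 0" using zero by simp
  define J where "J = Suc q"
  have bound: "(\<Sum>j=1..J. (y\<^sup>2) ^ (j\<^sup>2)) \<le> q" if y: "0 < y" "y < 1" for y :: real
  proof -
    define x where "x = y\<^sup>2"
    have x: "0 < x" "x < 1" using y by (auto simp: x_def abs_square_less_1)
    have "(\<Sum>j=1..J. x ^ (j\<^sup>2)) \<le> (\<Sum>n=1..M. f n / n) / (1 - x) + q + real M * x ^ M / (1 - x)"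
      if M: "J\<^sup>2 \<le> M" for M
    proof -
      have "(\<Sum>n=1..M. f n * (x ^ n / (1 - x ^ n)))
        = (\<Sum>n=1..M. f n / n) / (1 - x) - (\<Sum>n=1..M. f n * lambert_weight x n)"
        by (simp add: lambert_weight_def right_diff_distrib sum_subtractf sum_divide_distrib)
      moreover have "\<bar>\<Sum>n=1..M. f n * lambert_weight x n\<bar> \<le> q"
        using abs_sum_lambert_weight_le[OF y] by (simp add: x_def)
      ultimately show ?thesis
        using truncated_lambert_series[OF x, of M] sum_squares_le_lambert[OF x(1) M] by linarith
    qed
    moreover have "(\<lambda>M. real M * x ^ M) \<longlonglongrightarrow> 0"
      using powser_times_n_limit_0[of x] x by simp
    then have "(\<lambda>M. (\<Sum>n=1..M. f n / n) / (1 - x) + q + real M * x ^ M / (1 - x))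
        \<longlonglongrightarrow> 0 / (1 - x) + q + 0 / (1 - x)"
      using x by (intro tendsto_intros L) auto
    ultimately have "(\<Sum>j=1..J. x ^ (j\<^sup>2)) \<le> 0 / (1 - x) + q + 0 / (1 - x)"
      by (intro LIMSEQ_le_const) auto
    then show ?thesis by (simp add: x_def)
  qed
  have "((\<lambda>y :: real. \<Sum>j=1..J. (y\<^sup>2) ^ (j\<^sup>2)) \<longlongrightarrow> (\<Sum>j=1..J. (1\<^sup>2) ^ (j\<^sup>2))) (at_left 1)"
    by (intro tendsto_intros)
  moreover have "eventually (\<lambda>y :: real. (\<Sum>j=1..J. (y\<^sup>2) ^ (j\<^sup>2)) \<le> q) (at_left 1)"
    using eventually_at_left_real[of 0 "1 :: real"] bound by (auto elim: eventually_mono)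
  ultimately have "(\<Sum>j=1..J. ((1 :: real)\<^sup>2) ^ (j\<^sup>2)) \<le> q"
    by (intro tendsto_upperbound) auto
  then show False by (simp add: J_def)
qed

end

section \<open>A zero near 1 makes the value at 1 small\<close>

lemma powr_minus_one_le:
  fixes x \<delta> :: real
  assumes "x \<ge> 1"
  shows "x powr \<delta> - 1 \<le> \<delta> * ln x * x powr \<delta>"
proof -
  have "1 - \<delta> * ln x \<le> exp (- (\<delta> * ln x))"
    using exp_ge_add_one_self[of "- (\<delta> * ln x)"] by simp
  then have "(1 - \<delta> * ln x) * exp (\<delta> * ln x) \<le> exp (- (\<delta> * ln x)) * exp (\<delta> * ln x)"
    by (intro mult_right_mono) auto
  then show ?thesis using assms by (simp add: powr_def algebra_simps flip: exp_add)
qed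

text \<open>
By concavity of \<open>\<delta> \<mapsto> log (1 - \<delta>) + \<delta> log 3\<close> the extreme case is \<open>\<delta> = 1/8\<close>, where the claim is
\<open>(8/7)\<^sup>8 \<le> 3\<close>. The proof uses the chord of the exponential function between 0 and \<open>log (7/8)\<close>.
\<close>
lemma one_le_mult_powr:
  fixes x \<delta> :: real
  assumes "0 \<le> \<delta>" "\<delta> \<le> 1/8" "3 \<le> x"
  shows "1 \<le> (1 - \<delta>) * x powr \<delta>"
proof -
  define l where "l = ln (8/7 :: real)"
  have l: "exp (- l) = 7/8" "l > 0" by (auto simp: l_def exp_minus)
  have "exp ((1 - 8 * \<delta>) * 0 + (8 * \<delta>) * (- l)) \<le> (1 - 8 * \<delta>) * exp 0 + (8 * \<delta>) * exp (- l)"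
    using convex_onD[OF exp_convex, of "8 * \<delta>" 0 "- l"] assms by simp
  then have "exp (- (8 * \<delta> * l)) \<le> 1 - \<delta>" by (simp add: l(1))
  moreover have "exp (8 * \<delta> * l) \<le> x powr \<delta>"
  proof -
    have "8 * l = ln ((8/7) ^ 8)" by (simp add: l_def ln_realpow)
    also have "\<dots> \<le> ln x" using assms by (subst ln_le_cancel_iff) (auto simp: power_def)
    finally have "\<delta> * (8 * l) \<le> \<delta> * ln x" using assms by (intro mult_left_mono)
    then show ?thesis using assms by (simp add: powr_def mult_ac)
  qed
  ultimately have "exp (- (8 * \<delta> * l)) * exp (8 * \<delta> * l) \<le> (1 - \<delta>) * x powr \<delta>"
    using assms by (intro mult_mono) auto
  then show ?thesis by (simp flip: exp_add)
qed

text \<open>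
The coefficients of \<open>L(1 - \<delta>) - L(1)\<close>. Working with this difference directly replaces the derivative of the
\<open>L\<close>-function and the mean value theorem.
\<close>
definition powr_gap :: "real \<Rightarrow> real \<Rightarrow> real" where
  "powr_gap \<delta> x = x powr (- (1 - \<delta>)) - x powr (- 1)"

lemma powr_gap_eq: "x > 0 \<Longrightarrow> powr_gap \<delta> x = (x powr \<delta> - 1) / x"
  by (simp add: powr_gap_def powr_diff powr_minus field_simps)

lemma powr_gap_nonneg: "x \<ge> 1 \<Longrightarrow> \<delta> \<ge> 0 \<Longrightarrow> powr_gap \<delta> x \<ge> 0"
  by (simp add: powr_gap_eq ge_one_powr_ge_zero)

lemma powr_gap_le:
  assumes "1 \<le> x" "x \<le> y" "\<delta> \<ge> 0"
  shows "powr_gap \<delta> x \<le> \<delta> * ln y * y powr \<delta> / x"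
proof -
  have "x powr \<delta> - 1 \<le> \<delta> * ln x * x powr \<delta>"
    by (rule powr_minus_one_le[OF assms(1)])
  also have "\<dots> \<le> \<delta> * ln y * y powr \<delta>"
    using assms by (intro mult_mono powr_mono2) auto
  finally show ?thesis using assms by (simp add: powr_gap_eq divide_right_mono)
qed

text \<open>
The derivative is \<open>(1 - (1 - \<delta>) x\<^sup>\<delta>) / x\<^sup>2\<close>. Monotonicity from 3 on is what Abel summation of the terms beyond
the modulus needs, as a non-principal character has modulus at least 3.
\<close>
lemma powr_gap_decreasing:
  assumes "0 \<le> \<delta>" "\<delta> \<le> 1/8" "3 \<le> x" "x \<le> y"
  shows "powr_gap \<delta> y \<le> powr_gap \<delta> x"
proof (rule DERIV_nonpos_imp_nonincreasing[OF assms(4)])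
  fix z assume z: "x \<le> z" "z \<le> y"
  then have "z > 0" using assms by simp
  have "(powr_gap \<delta> has_real_derivative
      (- (1 - \<delta>) * z powr (- (1 - \<delta>) - 1) - (- 1) * z powr (- 1 - 1))) (at z)"
    unfolding powr_gap_def[abs_def]
    by (intro DERIV_diff has_real_derivative_powr \<open>z > 0\<close>)
  moreover have "- (1 - \<delta>) * z powr (- (1 - \<delta>) - 1) - (- 1) * z powr (- 1 - 1)
      = (1 - (1 - \<delta>) * z powr \<delta>) * z powr (- 2)"
  proof -
    have "z powr (- (1 - \<delta>) - 1) = z powr \<delta> * z powr (- 2)"
      by (simp flip: powr_add)
    then show ?thesis by (simp add: algebra_simps)
  qed
  moreover have "(1 - (1 - \<delta>) * z powr \<delta>) * z powr (- 2) \<le> 0"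
    using one_le_mult_powr[of \<delta> z] assms z by (intro mult_nonpos_nonneg) auto
  ultimately show "\<exists>d. (powr_gap \<delta> has_real_derivative d) (at z) \<and> d \<le> 0" by metis
qed

lemma ln_ge_1: "x \<ge> 3 \<Longrightarrow> ln x \<ge> (1 :: real)"
  using exp_le by (intro ln_ge_iff[THEN iffD2]) auto

context nonprincipal_quadratic_char
begin

text \<open>
As \<open>L(1 - \<delta>) = 0\<close>, \<open>L(1)\<close> is minus the sum of \<open>f\<close> against \<open>powr_gap \<delta>\<close>. With
\<open>C = \<delta> q\<^sup>\<delta> log q\<close>, the first \<open>q\<close> terms are at most \<open>C / n\<close> in absolute value and contribute \<open>C log q\<close> (the
gap vanishes at \<open>n = 1\<close>, which removes the constant from the harmonic sum). By Abel summation the remaining terms contribute at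
most \<open>q\<close> times the gap at \<open>q\<close>, which is at most \<open>C\<close>.
\<close>
theorem real_L_one_le:
  assumes "q \<ge> 3" "0 \<le> \<delta>" "\<delta> \<le> 1/8" and zero: "real_L f (1 - \<delta>) = 0"
  shows "real_L f 1 \<le> 2 * \<delta> * real q powr \<delta> * ln q ^ 2"
proof -
  define h where "h n = powr_gap \<delta> (real n)" for n
  define C where "C = \<delta> * ln q * real q powr \<delta>"
  have lnq: "ln (real q) \<ge> 1" using assms(1) by (intro ln_ge_1) simp
  have "C \<ge> 0" using lnq assms(2) by (simp add: C_def)
  have sm: "summable (\<lambda>n. f (Suc n) * real (Suc n) powr (- (1 - \<delta>)))"
           "summable (\<lambda>n. f (Suc n) * real (Suc n) powr (- 1))"
    using summable_real_L[of "1 - \<delta>"] summable_real_L[of 1] assms by auto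
  have diff_term: "f (Suc n) * h (Suc n) =
      f (Suc n) * real (Suc n) powr (- (1 - \<delta>)) - f (Suc n) * real (Suc n) powr (- 1)" for n
    by (simp only: h_def powr_gap_def right_diff_distrib)
  have smh: "summable (\<lambda>n. f (Suc n) * h (Suc n))"
    unfolding diff_term by (rule summable_diff[OF sm])
  have "real_L f 1 = - (\<Sum>n. f (Suc n) * h (Suc n))"
    using zero suminf_diff[OF sm] unfolding diff_term real_L_def by simp
  also have "(\<Sum>n. f (Suc n) * h (Suc n)) =
      (\<Sum>n. f (Suc (n + q)) * h (Suc (n + q))) + (\<Sum>n<q. f (Suc n) * h (Suc n))"
    by (rule suminf_split_initial_segment[OF smh])
  finally have split: "real_L f 1 \<le>
      \<bar>\<Sum>n. f (Suc (n + q)) * h (Suc (n + q))\<bar> + \<bar>\<Sum>n<q. f (Suc n) * h (Suc n)\<bar>"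
    by linarith
  have decr: "h n \<le> h m" if "3 \<le> m" "m \<le> n" for m n
    unfolding h_def using that assms by (intro powr_gap_decreasing) auto
  have lim0: "h \<longlonglongrightarrow> 0"
  proof -
    have "h \<longlonglongrightarrow> 0 - 0" unfolding h_def powr_gap_def
      using assms by (intro tendsto_diff tendsto_neg_powr filterlim_real_sequentially) auto
    then show ?thesis by simp
  qed
  have "\<bar>\<Sum>n. f (Suc (n + q)) * h (Suc (n + q))\<bar> \<le> q * h (Suc (0 + q))"
  proof (rule abel_suminf_bound)
    show "\<bar>\<Sum>i<m. f (Suc (M + i + q))\<bar> \<le> real q" for M m
      using abs_sum_Suc_le_modulus[of "M + q" m] by (simp add: add_ac)
    show "h (Suc (Suc n + q)) \<le> h (Suc (n + q))" for n
      using assms(1) by (intro decr) auto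
    show "(\<lambda>n. h (Suc (n + q))) \<longlonglongrightarrow> 0"
      using LIMSEQ_ignore_initial_segment[OF lim0, of "Suc q"] by simp
  qed
  also have "\<dots> \<le> q * h q" using assms(1) decr by (intro mult_left_mono) auto
  also have "\<dots> \<le> C"
    using powr_gap_le[of q q \<delta>] assms by (simp add: h_def C_def field_simps)
  finally have tail: "\<bar>\<Sum>n. f (Suc (n + q)) * h (Suc (n + q))\<bar> \<le> C" .
  obtain q' where q': "q = Suc q'" using assms(1) by (cases q) auto
  have "\<bar>\<Sum>n<q. f (Suc n) * h (Suc n)\<bar> \<le> (\<Sum>n<q. h (Suc n))"
  proof (rule sum_abs[THEN order_trans], rule sum_mono)
    fix n
    have "h (Suc n) \<ge> 0" unfolding h_def using assms by (intro powr_gap_nonneg) auto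
    then show "\<bar>f (Suc n) * h (Suc n)\<bar> \<le> h (Suc n)"
      using abs_le_1[of "Suc n"] by (simp add: abs_mult mult_left_le_one_le)
  qed
  also have "\<dots> = (\<Sum>n<q'. h (Suc (Suc n)))"
    by (simp add: q' sum.lessThan_Suc_shift h_def powr_gap_def del: sum.lessThan_Suc)
  also have "\<dots> \<le> (\<Sum>n<q'. C * inverse (real (Suc (Suc n))))"
  proof (rule sum_mono)
    fix n assume "n \<in> {..<q'}"
    then show "h (Suc (Suc n)) \<le> C * inverse (real (Suc (Suc n)))"
      using powr_gap_le[of "real (Suc (Suc n))" "real q" \<delta>] assms(2) q'
      unfolding h_def C_def by (simp add: divide_inverse)
  qed
  also have "\<dots> = C * (harm q - 1)"
    by (simp add: harm_altdef q' sum.lessThan_Suc_shift sum_distrib_left del: sum.lessThan_Suc)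
  also have "\<dots> \<le> C * ln q"
    using euler_mascheroni_sequence_decreasing[of 1 q] assms(1) \<open>C \<ge> 0\<close>
    by (intro mult_left_mono) (auto simp: harm_def)
  finally have head: "\<bar>\<Sum>n<q. f (Suc n) * h (Suc n)\<bar> \<le> C * ln q" .
  have "C * 1 \<le> C * ln q" using lnq \<open>C \<ge> 0\<close> by (intro mult_left_mono)
  then have "real_L f 1 \<le> 2 * (C * ln q)" using split tail head by linarith
  then show ?thesis by (simp add: C_def power2_eq_square mult_ac)
qed

end

section \<open>From complex-valued characters to real sequences\<close>

lemma real_nonprincipal_char_imp_quadratic:
  assumes "nonprincipal_char D chi" and "real_char chi"
  shows "nonprincipal_quadratic_char D (\<lambda>n. Re (chi n))"
proof -
  have dc: "dirichlet_char D chi" using assms(1) by (simp add: nonprincipal_char_def)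
  have im: "Im (chi n) = 0" for n using assms(2) by (simp add: real_char_def complex_is_Real_iff)
  have val: "Re (chi n) \<in> {-1, 0, 1}" for n
  proof (cases "coprime n D")
    case True
    then show ?thesis using norm_dirichlet_char_coprime[OF dc True] im[of n]
      by (auto simp: cmod_eq_Re)
  next
    case False
    then have "chi n = 0" using dc unfolding dirichlet_char_def by blast
    then show ?thesis by simp
  qed
  show ?thesis
  proof
    show "D > 0" using dc by (simp add: dirichlet_char_def)
    show "Re (chi (m * n)) = Re (chi m) * Re (chi n)" for m n
      using dc im by (simp add: dirichlet_char_def)
    show "Re (chi m) = Re (chi n)" if "[m = n] (mod D)" for m n
      using dirichlet_char_cong[OF dc that] by simp
    show "Re (chi 1) = 1" using dirichlet_char_one[OF dc] by simp
    obtain a where a: "coprime a D" "chi a \<noteq> 1" using nonprincipal_char_witness[OF assms(1)] .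
    then show "\<exists>a. coprime a D \<and> Re (chi a) \<noteq> 1"
      using im[of a] by (auto simp: complex_eq_iff)
    show "Re (chi n) \<in> {-1, 0, 1}" for n by (rule val)
  qed
qed

lemma dirichlet_L_eq_real_L:
  assumes "nonprincipal_char D chi" and "real_char chi" and "s > 0"
  shows "dirichlet_L chi (of_real s) = of_real (real_L (\<lambda>n. Re (chi n)) s)"
proof -
  interpret nonprincipal_quadratic_char D "\<lambda>n. Re (chi n)"
    by (rule real_nonprincipal_char_imp_quadratic[OF assms(1,2)])
  have "chi (Suc n) / of_nat (Suc n) powr (of_real s)
      = of_real (Re (chi (Suc n)) * real (Suc n) powr (- s))" for n
  proof -
    have "chi (Suc n) = of_real (Re (chi (Suc n)))"
      using assms(2) by (simp add: real_char_def)
    moreover have "(of_nat (Suc n) :: complex) powr (of_real s) = of_real (real (Suc n) powr s)"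
      using powr_of_real[of "real (Suc n)" s] by (simp only: of_real_of_nat_eq of_nat_0_le_iff)
    ultimately show ?thesis
      by (metis of_real_divide powr_minus_divide times_divide_eq_right mult.right_neutral)
  qed
  then show ?thesis
    unfolding dirichlet_L_def real_L_def
    using suminf_of_real[OF summable_real_L[OF assms(3)], where 'a = complex] by simp
qed

section \<open>The character modulo 3\<close>

definition chi3 :: "nat \<Rightarrow> complex" where
  "chi3 n = (if n mod 3 = 1 then 1 else if n mod 3 = 2 then -1 else 0)"

lemma real_char_chi3: "real_char chi3"
  by (simp add: real_char_def chi3_def)

lemma mod_3_cases:
  fixes n :: nat
  obtains "n mod 3 = 0" | "n mod 3 = 1" | "n mod 3 = 2"
  by linarith

lemma coprime_3_iff: "coprime n 3 \<longleftrightarrow> n mod 3 \<noteq> (0 :: nat)"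
proof -
  have "coprime 3 n \<longleftrightarrow> \<not> 3 dvd n"
    using prime_imp_coprime[of 3 n] by (auto simp: coprime_absorb_left)
  then show ?thesis by (simp add: coprime_commute dvd_eq_mod_eq_0)
qed

lemma dirichlet_char_chi3: "dirichlet_char 3 chi3"
proof -
  have "chi3 (m * n) = chi3 m * chi3 n" for m n
  proof -
    have "(m * n) mod 3 = ((m mod 3) * (n mod 3)) mod 3" by (simp add: mod_mult_eq)
    then show ?thesis
      by (cases m rule: mod_3_cases; cases n rule: mod_3_cases) (simp_all add: chi3_def)
  qed
  moreover have "chi3 n = 0 \<longleftrightarrow> \<not> coprime n 3" for n
    by (cases n rule: mod_3_cases) (simp_all add: chi3_def coprime_3_iff)
  ultimately show ?thesis by (simp add: dirichlet_char_def chi3_def)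
qed

lemma primitive_char_chi3: "primitive_char 3 chi3"
proof -
  have False if "d < 3" "induced_char 3 chi3 d \<psi>" for d \<psi>
  proof -
    have psi: "dirichlet_char d \<psi>" "d dvd 3" "chi3 2 = \<psi> 2"
      using that(2) by (auto simp: induced_char_def coprime_3_iff)
    have "d = 1" using psi(2) that(1) prime_nat_iff[of 3] by auto
    then have "\<psi> 2 = \<psi> 1" using psi(1) by (intro dirichlet_char_cong) auto
    then show False using dirichlet_char_one[OF psi(1)] psi(3) by (simp add: chi3_def)
  qed
  then show ?thesis using dirichlet_char_chi3 by (auto simp: primitive_char_def)
qed

lemma nonprincipal_char_chi3: "nonprincipal_char 3 chi3"
  by (rule primitive_char_imp_nonprincipal[OF primitive_char_chi3]) simp

text \<open>
The values run through 0, 1, -1 periodically, so partial sums from the start are 0 or 1. This is sharper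
than the general bound by the modulus, and the bounds for \<open>L(s, chi3)\<close> depend on it.
\<close>
lemma abs_sum_chi3_le: "\<bar>\<Sum>i<m. Re (chi3 (M + i))\<bar> \<le> 1"
proof -
  have init: "(\<Sum>i<m. Re (chi3 i)) = (if m mod 3 = 2 then 1 else 0)" for m
  proof (induction m)
    case (Suc m)
    then show ?case
      by (cases m rule: mod_3_cases) (auto simp: chi3_def mod_Suc)
  qed simp
  have "(\<Sum>i<M + m. Re (chi3 i)) = (\<Sum>i<M. Re (chi3 i)) + (\<Sum>i<m. Re (chi3 (M + i)))"
    by (induction m) auto
  then show ?thesis unfolding init by (auto split: if_splits)
qed

text \<open>
The terms after the first sum up to at most \<open>2\<^sup>-\<^sup>s < 1\<close> in absolute value.
\<close>
lemma real_L_chi3_pos: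
  assumes "s > 0"
  shows "real_L (\<lambda>n. Re (chi3 n)) s > 0"
proof -
  interpret nonprincipal_quadratic_char 3 "\<lambda>n. Re (chi3 n)"
    by (rule real_nonprincipal_char_imp_quadratic[OF nonprincipal_char_chi3 real_char_chi3])
  have "real_L (\<lambda>n. Re (chi3 n)) s =
      (\<Sum>n. Re (chi3 (Suc (Suc n))) * real (Suc (Suc n)) powr (- s)) + 1"
    using suminf_split_head[OF summable_real_L[OF assms]]
    by (simp add: real_L_def chi3_def)
  moreover have "\<bar>\<Sum>n. Re (chi3 (Suc (Suc n))) * real (Suc (Suc n)) powr (- s)\<bar>
      \<le> 1 * real (Suc (Suc 0)) powr (- s)"
  proof (rule abel_suminf_bound)
    show "\<bar>\<Sum>i<m. Re (chi3 (Suc (Suc (M + i))))\<bar> \<le> 1" for M m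
      using abs_sum_chi3_le[of "M + 2" m] by simp
    show "real (Suc (Suc (Suc n))) powr - s \<le> real (Suc (Suc n)) powr - s" for n
      by (rule powr_minus_decreasing[OF assms])
    show "(\<lambda>n. real (Suc (Suc n)) powr - s) \<longlonglongrightarrow> 0"
      by (rule LIMSEQ_Suc[OF powr_minus_tendsto_0[OF assms]])
  qed
  moreover have "real (Suc (Suc 0)) powr (- s) < 1" using assms by (simp add: powr_less_one)
  ultimately show ?thesis by linarith
qed

lemma real_L_chi3_one_le: "real_L (\<lambda>n. Re (chi3 n)) 1 \<le> 1"
proof -
  interpret nonprincipal_quadratic_char 3 "\<lambda>n. Re (chi3 n)"
    by (rule real_nonprincipal_char_imp_quadratic[OF nonprincipal_char_chi3 real_char_chi3])
  have "\<bar>\<Sum>n. Re (chi3 (Suc n)) * real (Suc n) powr (- 1)\<bar> \<le> 1 * real (Suc 0) powr (- 1)"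
  proof (rule abel_suminf_bound)
    show "\<bar>\<Sum>i<m. Re (chi3 (Suc (M + i)))\<bar> \<le> 1" for M m
      using abs_sum_chi3_le[of "M + 1" m] by simp
  qed (use powr_minus_decreasing[of 1] powr_minus_tendsto_0[of 1] in auto)
  then show ?thesis by (simp add: real_L_def)
qed

section \<open>Repulsion of exceptional zeros\<close>

text \<open>
The Deuring bound for a real zero, with \<open>U = k D (1 - \<delta>)\<close> replaced by the larger \<open>k D\<close>. The replacement
is harmless because both moduli are at least 3, so that \<open>U > 1\<close> and the powers of \<open>U\<close> and \<open>ln U\<close> are increasing.
\<close>
lemma deuring_real_zero:
  assumes "deuring_constant c"
    and "nonprincipal_char k chik" "real_char chik"
    and "dirichlet_L chik (of_real (1 - \<delta>)) = 0"
    and "0 < \<delta>" "\<delta> \<le> 1/8"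
    and "nonprincipal_char D chiD" "real_char chiD"
    and "nonprincipal_char (k * D) (\<lambda>n. chik n * chiD n)"
    and "1 / (2 * (1 - 3 * \<delta>)) < b" "b < 1 / (2 * \<delta>)"
  shows "c \<le> Re (dirichlet_L chiD 1) * ((real k * real D) powr (b * \<delta>) * ln (real k * real D) ^ 3)"
proof -
  define V where "V = real k * real D"
  define U where "U = real k * cmod (Complex (1 - \<delta>) 0) * real D"
  have "c > 0" using assms(1) by (simp add: deuring_constant_def)
  have cm: "cmod (Complex (1 - \<delta>) 0) = 1 - \<delta>"
    using assms(6) by (simp add: complex_norm)
  then have U: "U = V * (1 - \<delta>)" by (simp add: U_def V_def)
  have zero: "dirichlet_L chik (Complex (1 - \<delta>) 0) = 0"
    using assms(4) by (simp add: complex_of_real_def)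
  have "k \<ge> 3" "D \<ge> 3" using assms nonprincipal_char_modulus_ge_3 by blast+
  then have "3 * 3 \<le> V" unfolding V_def by (intro mult_mono) auto
  then have "9 * (7/8) \<le> U" unfolding U using assms(6) by (intro mult_mono) auto
  then have "U > 1" by simp
  have "U \<le> V * 1" unfolding U using assms(5) \<open>3 * 3 \<le> V\<close> by (intro mult_left_mono) auto
  then have "U \<le> V" by simp
  have "\<delta> < 1/4" using assms(6) by simp
  then have gam: "if real_char chik then \<delta> < 1/4 else \<delta> \<le> 1/8" using assms(3) by simp
  have Lge: "c / (U powr (b * \<delta>) * ln U ^ 3) \<le> Re (dirichlet_L chiD 1)"
    using assms(1)[unfolded deuring_constant_def Let_def, THEN conjunct2, rule_format,
        OF assms(2) zero assms(5) gam assms(7-11)] unfolding U_def .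
  have "1 / (2 * (1 - 3 * \<delta>)) > 0" using assms(6) by simp
  then have "b > 0" using assms(10) by (rule less_trans)
  then have "b * \<delta> \<ge> 0" using assms(5) by simp
  have Upos: "0 < U powr (b * \<delta>) * ln U ^ 3" using \<open>U > 1\<close> by simp
  moreover have "U powr (b * \<delta>) * ln U ^ 3 \<le> V powr (b * \<delta>) * ln V ^ 3"
    using \<open>U > 1\<close> \<open>U \<le> V\<close> \<open>b * \<delta> \<ge> 0\<close>
    by (intro mult_mono powr_mono2 power_mono) auto
  moreover have "Re (dirichlet_L chiD 1) \<ge> 0"
    using Lge divide_pos_pos[OF \<open>c > 0\<close> Upos] by linarith
  ultimately have "Re (dirichlet_L chiD 1) * (U powr (b * \<delta>) * ln U ^ 3)
      \<le> Re (dirichlet_L chiD 1) * (V powr (b * \<delta>) * ln V ^ 3)"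
    by (intro mult_left_mono)
  moreover have "c \<le> Re (dirichlet_L chiD 1) * (U powr (b * \<delta>) * ln U ^ 3)"
    using Lge Upos by (simp add: divide_le_eq)
  ultimately show ?thesis by (simp add: V_def)
qed

lemma exceptional_char_zero:
  assumes "exceptional_char c \<gamma> b D chi" and "\<gamma> \<le> 1/8"
  obtains \<delta> where "0 < \<delta>" "\<delta> \<le> \<gamma>" "\<delta> \<le> c / (32 * ln (real D) ^ 5 * real D powr (b * \<gamma>))"
    "dirichlet_L chi (of_real (1 - \<delta>)) = 0"
proof -
  have chi: "nonprincipal_char D chi" "real_char chi"
    using assms(1) primitive_char_imp_nonprincipal by (auto simp: exceptional_char_def)
  interpret nonprincipal_quadratic_char D "\<lambda>n. Re (chi n)"
    by (rule real_nonprincipal_char_imp_quadratic[OF chi])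
  obtain \<sigma> where \<sigma>: "\<sigma> \<ge> 1 - min \<gamma> (c / (32 * ln (real D) ^ 5 * real D powr (b * \<gamma>)))"
    "\<sigma> \<le> 1" "dirichlet_L chi (of_real \<sigma>) = 0"
    using assms(1) by (auto simp: exceptional_char_def)
  have "\<sigma> \<noteq> 1"
    using \<sigma>(3) dirichlet_L_eq_real_L[OF chi, of 1] real_L_one_nonzero by auto
  with \<sigma> show ?thesis by (intro that[of "1 - \<sigma>"]) auto
qed

lemma exceptional_char_ne_chi3:
  assumes "exceptional_char c \<gamma> b D chi" and "\<gamma> \<le> 1/8"
  shows "chi \<noteq> chi3"
proof
  assume "chi = chi3"
  obtain \<delta> where \<delta>: "0 < \<delta>" "\<delta> \<le> \<gamma>" "dirichlet_L chi (of_real (1 - \<delta>)) = 0"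
    using exceptional_char_zero[OF assms] by metis
  then show False
    using dirichlet_L_eq_real_L[OF nonprincipal_char_chi3 real_char_chi3, of "1 - \<delta>"]
      real_L_chi3_pos[of "1 - \<delta>"] assms(2) \<open>chi = chi3\<close> by simp
qed

locale deuring_setting =
  fixes c \<gamma> b :: real
  assumes deuring: "deuring_constant c"
    and gamma: "0 < \<gamma>" "\<gamma> \<le> 1/8"
    and b: "1 / (2 * (1 - 3 * \<gamma>)) < b" "b < 1 / (2 * \<gamma>)"
begin

text \<open>
The exponent with which the Deuring bound is applied. It is bounded by 1, so that \<open>D powr (\<beta> * \<delta>)\<close> is
controlled by \<open>\<delta> ln D\<close>, and by \<open>b\<close>, so that it is also absorbed by \<open>D powr (b * \<gamma>)\<close>.
\<close>
definition \<beta> :: real where "\<beta> = min b 1"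

lemma c_pos: "c > 0"
  using deuring by (simp add: deuring_constant_def)

lemma beta_nonneg: "0 \<le> \<beta>"
proof -
  have "0 < 1 / (2 * (1 - 3 * \<gamma>))" using gamma by simp
  then have "0 < b" using b(1) by (rule less_trans)
  then show ?thesis by (simp add: \<beta>_def)
qed

text \<open>
The admissible range of exponents grows as \<open>\<delta>\<close> decreases, so it contains \<open>b\<close>; for \<open>\<delta> \<le> 1/8\<close> it
contains \<open>(4/5, 4)\<close>, hence 1.
\<close>
lemma beta_admissible:
  assumes "0 < \<delta>" "\<delta> \<le> \<gamma>"
  shows "1 / (2 * (1 - 3 * \<delta>)) < \<beta>" "\<beta> < 1 / (2 * \<delta>)"
proof -
  have "1 / (2 * (1 - 3 * \<delta>)) \<le> 1 / (2 * (1 - 3 * \<gamma>))"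
    using assms gamma by (intro divide_left_mono) auto
  moreover have "1 / (2 * (1 - 3 * \<gamma>)) < 1" using gamma by simp
  ultimately show "1 / (2 * (1 - 3 * \<delta>)) < \<beta>" using b(1) by (auto simp: \<beta>_def)
  have "1 < 1 / (2 * \<delta>)" using assms gamma by simp
  then show "\<beta> < 1 / (2 * \<delta>)" by (simp add: \<beta>_def min_less_iff_disj)
qed

lemma powr_beta_le:
  assumes "0 < \<delta>" "\<delta> \<le> \<gamma>" "1 \<le> x"
  shows "x powr (\<beta> * \<delta>) \<le> x powr (b * \<gamma>)" "x powr (\<beta> * \<delta>) \<le> x powr \<delta>"
proof -
  have "\<beta> * \<delta> \<le> b * \<gamma>" using assms beta_nonneg by (intro mult_mono) (auto simp: \<beta>_def)
  then show "x powr (\<beta> * \<delta>) \<le> x powr (b * \<gamma>)" using assms(3) by (intro powr_mono)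
  have "\<beta> * \<delta> \<le> 1 * \<delta>" using assms by (intro mult_right_mono) (auto simp: \<beta>_def)
  then show "x powr (\<beta> * \<delta>) \<le> x powr \<delta>" using assms(3) by (intro powr_mono) auto
qed

text \<open>
Applied to \<open>chi\<close> and \<open>chi3\<close>, the Deuring bound gives
\<open>c \<le> 3\<^sup>\<beta>\<^sup>\<delta> D\<^sup>\<beta>\<^sup>\<delta> ln\<^sup>3(3 D) \<le> 3\<^sup>1\<^sup>/\<^sup>8 D\<^sup>b\<^sup>\<gamma> (2 ln D)\<^sup>3\<close>. The factor \<open>D\<^sup>b\<^sup>\<gamma>\<close> cancels against the
one in the width of the exceptional interval, and \<open>\<delta>\<close> is at most \<open>3\<^sup>1\<^sup>/\<^sup>8 / (4 ln\<^sup>2 D)\<close>; finally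
\<open>3\<^sup>1\<^sup>/\<^sup>8 \<le> 6/5\<close> and \<open>ln D \<ge> 1\<close>.
\<close>
lemma exceptional_zero_close:
  assumes "exceptional_char c \<gamma> b D chi"
    and \<delta>: "0 < \<delta>" "\<delta> \<le> \<gamma>" "\<delta> \<le> c / (32 * ln (real D) ^ 5 * real D powr (b * \<gamma>))"
      "dirichlet_L chi (of_real (1 - \<delta>)) = 0"
  shows "\<delta> * ln (real D) \<le> 3/10"
proof -
  have prim: "primitive_char D chi" and "D > 1" and re: "real_char chi"
    using assms(1) by (auto simp: exceptional_char_def)
  have np: "nonprincipal_char D chi" using prim \<open>D > 1\<close> by (rule primitive_char_imp_nonprincipal)
  then have D: "real D \<ge> 3" using nonprincipal_char_modulus_ge_3 by force
  have lnD: "ln (real D) \<ge> 1" using D by (rule ln_ge_1)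
  define B where "B = real D powr (b * \<gamma>)"
  have "B > 0" using D by (simp add: B_def)
  have prod: "nonprincipal_char (D * 3) (\<lambda>n. chi n * chi3 n)"
    using exceptional_char_ne_chi3[OF assms(1) gamma(2)]
    by (intro nonprincipal_product_of_distinct_primitive_chars prim primitive_char_chi3 real_char_chi3) auto
  have "c \<le> Re (dirichlet_L chi3 1)
      * ((real D * real 3) powr (\<beta> * \<delta>) * ln (real D * real 3) ^ 3)"
    using gamma \<delta> by (intro deuring_real_zero[OF deuring np re \<delta>(4)] nonprincipal_char_chi3
        real_char_chi3 prod beta_admissible) auto
  also have "\<dots> \<le> 1 * ((B * (6/5)) * (2 * ln (real D)) ^ 3)"
  proof (intro mult_mono)
    show "Re (dirichlet_L chi3 1) \<le> 1"
      using dirichlet_L_eq_real_L[OF nonprincipal_char_chi3 real_char_chi3, of 1]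
        real_L_chi3_one_le by simp
    have "(3 :: real) powr (\<beta> * \<delta>) \<le> 3 powr \<delta>" using \<delta> by (intro powr_beta_le) auto
    also have "\<dots> \<le> 3 powr (1/8)" using \<delta>(2) gamma(2) by (intro powr_mono) auto
    also have "\<dots> \<le> ((6/5) ^ 8) powr (1/8)" by (intro powr_mono2) (auto simp: power_def)
    also have "\<dots> = ((6/5) powr real 8) powr (1/8)" by (subst powr_realpow) auto
    also have "\<dots> = 6/5" unfolding powr_powr by simp
    finally have "3 powr (\<beta> * \<delta>) \<le> (6/5 :: real)" .
    moreover have "real D powr (\<beta> * \<delta>) \<le> B"
      unfolding B_def using \<delta> D by (intro powr_beta_le) auto
    ultimately show "(real D * real 3) powr (\<beta> * \<delta>) \<le> B * (6/5)"
      using \<open>B > 0\<close> mult_mono[of "real D powr (\<beta> * \<delta>)" B "3 powr (\<beta> * \<delta>)" "6/5"]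
      by (simp add: powr_mult)
    have "ln (real D * real 3) \<le> 2 * ln (real D)" using D by (simp add: ln_mult)
    then show "ln (real D * real 3) ^ 3 \<le> (2 * ln (real D)) ^ 3"
      using D by (intro power_mono) auto
  qed (use D \<open>B > 0\<close> in auto)
  finally have c: "c \<le> (48/5) * B * ln (real D) ^ 3" by (simp add: power_mult_distrib)
  have "\<delta> \<le> (48/5) * B * ln (real D) ^ 3 / (32 * ln (real D) ^ 5 * B)"
    using \<delta>(3) divide_right_mono[OF c, of "32 * ln (real D) ^ 5 * B"] lnD \<open>B > 0\<close>
    unfolding B_def by (auto intro: order_trans)
  also have "\<dots> = 3 / 10 / ln (real D) ^ 2"
    using lnD \<open>B > 0\<close> by (simp add: eval_nat_numeral)
  finally have "\<delta> * ln (real D) \<le> 3 / 10 / ln (real D) ^ 2 * ln (real D)"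
    using lnD by (intro mult_right_mono) auto
  also have "\<dots> = 3 / 10 / ln (real D)" using lnD by (simp add: power2_eq_square)
  also have "\<dots> \<le> 3 / 10 / 1" using lnD by (intro divide_left_mono) auto
  finally show ?thesis by simp
qed

text \<open>
The zero of \<open>chi\<close>, whose modulus is the smaller one, is used against the value of \<open>chi'\<close> at 1: in this order
\<open>ln (D D')\<close> is at most \<open>2 ln D'\<close>, and the powers of \<open>ln D'\<close> from the two bounds for \<open>L(1, chi')\<close> cancel
against the width of the exceptional interval of \<open>chi'\<close>. What remains is \<open>2 \<le> D'\<^sup>\<delta>\<^sup>' D\<^sup>\<delta>\<close>, but the right side
is at most \<open>exp (3/5) < 2\<close>.
\<close>
lemma exceptional_char_unique_ordered:
  assumes ex: "exceptional_char c \<gamma> b D chi" and ex': "exceptional_char c \<gamma> b D' chi'"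
    and "D \<le> D'"
  shows "D = D' \<and> chi = chi'"
proof (rule ccontr)
  assume distinct: "\<not> (D = D' \<and> chi = chi')"
  have prim: "primitive_char D chi" "primitive_char D' chi'" and "D > 1" "D' > 1"
    and re: "real_char chi" "real_char chi'"
    using ex ex' by (auto simp: exceptional_char_def)
  have np: "nonprincipal_char D chi" "nonprincipal_char D' chi'"
    using prim \<open>D > 1\<close> \<open>D' > 1\<close> by (auto intro: primitive_char_imp_nonprincipal)
  then have D: "D \<ge> 3" "D' \<ge> 3" using nonprincipal_char_modulus_ge_3 by auto
  obtain \<delta> where \<delta>: "0 < \<delta>" "\<delta> \<le> \<gamma>" "\<delta> \<le> c / (32 * ln (real D) ^ 5 * real D powr (b * \<gamma>))"
    "dirichlet_L chi (of_real (1 - \<delta>)) = 0"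
    using exceptional_char_zero[OF ex gamma(2)] .
  obtain \<delta>' where \<delta>': "0 < \<delta>'" "\<delta>' \<le> \<gamma>"
    "\<delta>' \<le> c / (32 * ln (real D') ^ 5 * real D' powr (b * \<gamma>))"
    "dirichlet_L chi' (of_real (1 - \<delta>')) = 0"
    using exceptional_char_zero[OF ex' gamma(2)] .
  define L where "L = ln (real D')"
  define B where "B = real D' powr (b * \<gamma>)"
  have "L \<ge> 1" unfolding L_def using D by (intro ln_ge_1) auto
  have "B > 0" using D by (simp add: B_def)
  interpret nonprincipal_quadratic_char D' "\<lambda>n. Re (chi' n)"
    by (rule real_nonprincipal_char_imp_quadratic[OF np(2) re(2)])
  have "real_L (\<lambda>n. Re (chi' n)) (1 - \<delta>') = 0"
    using dirichlet_L_eq_real_L[OF np(2) re(2), of "1 - \<delta>'"] \<delta>' gamma by simp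
  then have "real_L (\<lambda>n. Re (chi' n)) 1 \<le> 2 * \<delta>' * real D' powr \<delta>' * L ^ 2"
    unfolding L_def using D \<delta>' gamma by (intro real_L_one_le) auto
  then have upper: "Re (dirichlet_L chi' 1) \<le> 2 * \<delta>' * real D' powr \<delta>' * L ^ 2"
    using dirichlet_L_eq_real_L[OF np(2) re(2), of 1] by simp
  have lnDD': "0 \<le> ln (real D * real D')" using D by (simp add: ln_mult)
  have "c \<le> Re (dirichlet_L chi' 1)
      * ((real D * real D') powr (\<beta> * \<delta>) * ln (real D * real D') ^ 3)"
    using gamma \<delta> distinct
    by (intro deuring_real_zero[OF deuring np(1) re(1) \<delta>(4)] np(2) re(2) beta_admissible
        nonprincipal_product_of_distinct_primitive_chars prim) auto
  also have "\<dots> \<le> (2 * \<delta>' * real D' powr \<delta>' * L ^ 2) * ((real D powr \<delta> * B) * (2 * L) ^ 3)"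
  proof (intro mult_mono upper)
    have "real D powr (\<beta> * \<delta>) \<le> real D powr \<delta>" using \<delta> D by (intro powr_beta_le) auto
    moreover have "real D' powr (\<beta> * \<delta>) \<le> B"
      unfolding B_def using \<delta> D by (intro powr_beta_le) auto
    ultimately show "(real D * real D') powr (\<beta> * \<delta>) \<le> real D powr \<delta> * B"
      using mult_mono[of "real D powr (\<beta> * \<delta>)" "real D powr \<delta>" "real D' powr (\<beta> * \<delta>)" B]
      by (simp add: powr_mult)
    have "ln (real D * real D') \<le> 2 * L"
      unfolding L_def using D \<open>D \<le> D'\<close> by (simp add: ln_mult)
    then show "ln (real D * real D') ^ 3 \<le> (2 * L) ^ 3" using lnDD' by (intro power_mono)
    show "0 \<le> (real D * real D') powr (\<beta> * \<delta>) * ln (real D * real D') ^ 3"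
      using lnDD' by simp
  qed (use \<delta>' \<open>L \<ge> 1\<close> \<open>B > 0\<close> lnDD' in auto)
  also have "\<dots> = (16 * L ^ 5 * B * (real D' powr \<delta>' * real D powr \<delta>)) * \<delta>'"
  proof -
    have "L ^ 5 = L ^ 2 * L ^ 3" by (simp flip: power_add)
    then show ?thesis by (simp add: power_mult_distrib)
  qed
  also have "\<dots> \<le> (16 * L ^ 5 * B * (real D' powr \<delta>' * real D powr \<delta>)) * (c / (32 * L ^ 5 * B))"
    using \<delta>'(3) \<open>L \<ge> 1\<close> \<open>B > 0\<close> unfolding L_def B_def by (intro mult_left_mono) auto
  also have "\<dots> = (real D' powr \<delta>' * real D powr \<delta>) / 2 * c"
    using \<open>L \<ge> 1\<close> \<open>B > 0\<close> by simp
  also have "\<dots> < c"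
  proof -
    have "real D' powr \<delta>' * real D powr \<delta> = exp (\<delta>' * ln (real D') + \<delta> * ln (real D))"
      using D by (simp add: powr_def exp_add)
    also have "\<dots> < exp (ln 2)"
      using exceptional_zero_close[OF ex \<delta>] exceptional_zero_close[OF ex' \<delta>'] ln2_ge_two_thirds
      by (subst exp_less_cancel_iff) linarith
    finally have "real D' powr \<delta>' * real D powr \<delta> / 2 < 1" by simp
    then show ?thesis using c_pos by (simp add: mult_less_cancel_right2)
  qed
  finally show False by simp
qed

end

theorem corollary3:
  fixes c\<^sub>1 \<gamma> b :: real
  assumes "deuring_constant c\<^sub>1"
    and "0 < \<gamma>" and "\<gamma> \<le> 1/8"
    and "1 / (2 * (1 - 3 * \<gamma>)) < b" and "b < 1 / (2 * \<gamma>)"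
  shows "\<forall>D chi D' chi'.
           exceptional_char c\<^sub>1 \<gamma> b D chi \<longrightarrow> exceptional_char c\<^sub>1 \<gamma> b D' chi' \<longrightarrow>
           D = D' \<and> chi = chi'"
proof -
  interpret deuring_setting c\<^sub>1 \<gamma> b by unfold_locales (use assms in auto)
  show ?thesis
  proof (intro allI impI)
    fix D chi D' chi'
    assume ex: "exceptional_char c\<^sub>1 \<gamma> b D chi" "exceptional_char c\<^sub>1 \<gamma> b D' chi'"
    show "D = D' \<and> chi = chi'"
    proof (cases "D \<le> D'")
      case True
      then show ?thesis by (rule exceptional_char_unique_ordered[OF ex])
    next
      case False
      then show ?thesis using exceptional_char_unique_ordered[OF ex(2,1)] by simp
    qed
  qed
qed

end
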